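(* For every $h\in\mathbb{N}$ and for $q\in\{1,2\}$, the critical protection rate of $G_q$ equals $\frac32 qh$, i.e. $C(G_q)=\frac{3}{2}qh$.
   Context: For $h\in\mathbb{N}$ let $[h]=\{1,\dots,h\}$, viewed as a path graph. Let $G_1=(\mathbb{Z}\,\Box\,\mathbb{Z})\,\Box\,[h]$ and $G_2=(\mathbb{Z}\boxtimes\mathbb{Z})\,\Box\,[h]$, where $\Box$ is the Cartesian product and $\boxtimes$ the strong product of graphs. Both have vertex set $\mathbb{Z}\times\mathbb{Z}\times[h]$; in $G_1$ a vertex is adjacent to its 4 horizontal nearest neighbours and the vertices directly above and below it; in $G_2$ to its 8 horizontal (king-move) neighbours and the vertices directly above and below it. The firefighter game on an infinite graph $G=(V,E)$ with protection function $\mathsf f:\mathbb{N}\to\mathbb{R}_{\ge0}$: a finite set $B(0)\subset V$ of burning vertices is given. At each turn $t\in\mathbb{N}$ the player first protects (permanently) some finite collection of non-burning vertices, subject to the constraint that in total at most $\mathsf f(t)$ vertices are protected by time $t$; then every unprotected neighbour of a burning vertex becomes burning. The player contains the fire if eventually no new burning vertices are created. The critical protection rate $C(G)$ is the number such that for $\mathsf f(t)=C(G)\,t$ there exists a finite starting set $B(0)$ for which no strategy contains the fire, while for every $\varepsilon>0$ and $\mathsf f(t)=(C(G)+\varepsilon)t$, for every finite $B(0)\subset V$ there is a strategy containing the fire. *)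

theory Defs
  imports Complex_Main "Graph_Theory.Pair_Digraph"
begin

text \<open>
  Undirected simple graphs, possibly infinite, are represented as symmetric loop-free digraphs,
  that is, as instances of \<^locale>\<open>pair_bidirected_digraph\<close>.
\<close>

definition int_path :: "int pair_pre_digraph" where
  "int_path = \<lparr> pverts = UNIV, parcs = {(u, v). v = u + 1 \<or> u = v + 1} \<rparr>"

definition nat_path :: "nat \<Rightarrow> nat pair_pre_digraph" where
  "nat_path h = \<lparr> pverts = {1..h},
     parcs = {(u, v). u \<in> {1..h} \<and> v \<in> {1..h} \<and> (v = u + 1 \<or> u = v + 1)} \<rparr>"

definition box_prod :: "'a pair_pre_digraph \<Rightarrow> 'b pair_pre_digraph \<Rightarrow> ('a \<times> 'b) pair_pre_digraph"
    (infixl "\<box>" 70) where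
  "G \<box> H = \<lparr> pverts = pverts G \<times> pverts H,
     parcs = {((a, b), (a', b')).
        (a, a') \<in> parcs G \<and> b = b' \<and> b \<in> pverts H \<or>
        a = a' \<and> a \<in> pverts G \<and> (b, b') \<in> parcs H} \<rparr>"

definition strong_prod :: "'a pair_pre_digraph \<Rightarrow> 'b pair_pre_digraph \<Rightarrow> ('a \<times> 'b) pair_pre_digraph"
    (infixl "\<boxtimes>" 70) where
  "G \<boxtimes> H = \<lparr> pverts = pverts G \<times> pverts H,
     parcs = parcs (G \<box> H) \<union>
       {((a, b), (a', b')). (a, a') \<in> parcs G \<and> (b, b') \<in> parcs H} \<rparr>"

definition G1 :: "nat \<Rightarrow> ((int \<times> int) \<times> nat) pair_pre_digraph" where
  "G1 h = (int_path \<box> int_path) \<box> nat_path h"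

definition G2 :: "nat \<Rightarrow> ((int \<times> int) \<times> nat) pair_pre_digraph" where
  "G2 h = (int_path \<boxtimes> int_path) \<box> nat_path h"

lemma bidirected_int_path: "pair_bidirected_digraph int_path"
  by unfold_locales (auto simp: int_path_def with_proj_def arcs_ends_def arc_to_ends_def
      symmetric_def sym_def)

lemma bidirected_nat_path: "pair_bidirected_digraph (nat_path h)"
  by unfold_locales (auto simp: nat_path_def with_proj_def arcs_ends_def arc_to_ends_def
      symmetric_def sym_def)

lemma pair_bidirected_digraph_iff:
  "pair_bidirected_digraph G \<longleftrightarrow>
     parcs G \<subseteq> pverts G \<times> pverts G \<and> sym (parcs G) \<and> irrefl (parcs G)"
  unfolding pair_bidirected_digraph_def pair_sym_digraph_def pair_sym_digraph_axioms_def
    pair_loopfree_digraph_def pair_loopfree_digraph_axioms_def pair_wf_digraph_def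
    symmetric_def arcs_ends_def arc_to_ends_def with_proj_def irrefl_def
  by fastforce

lemma bidirected_box_prod:
  assumes "pair_bidirected_digraph G" "pair_bidirected_digraph H"
  shows "pair_bidirected_digraph (G \<box> H)"
  using assms unfolding pair_bidirected_digraph_iff
  by (auto simp: box_prod_def sym_def irrefl_def)

lemma bidirected_strong_prod:
  assumes "pair_bidirected_digraph G" "pair_bidirected_digraph H"
  shows "pair_bidirected_digraph (G \<boxtimes> H)"
  using assms unfolding pair_bidirected_digraph_iff
  by (auto simp: strong_prod_def box_prod_def sym_def irrefl_def)

lemma bidirected_G1: "pair_bidirected_digraph (G1 h)"
  and bidirected_G2: "pair_bidirected_digraph (G2 h)"
  by (simp_all add: G1_def G2_def bidirected_box_prod bidirected_strong_prod
      bidirected_int_path bidirected_nat_path)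

lemma int_path_iff: "(a, b) \<in> parcs int_path \<longleftrightarrow> \<bar>a - b\<bar> = 1"
  by (auto simp: int_path_def)

lemma nat_path_iff:
  "(k, k') \<in> parcs (nat_path h) \<longleftrightarrow> k \<in> {1..h} \<and> k' \<in> {1..h} \<and> \<bar>int k - int k'\<bar> = 1"
  by (auto simp: nat_path_def)

lemma box_prod_iff:
  "((a, b), (a', b')) \<in> parcs (G \<box> H) \<longleftrightarrow>
     (a, a') \<in> parcs G \<and> b = b' \<and> b \<in> pverts H \<or>
     a = a' \<and> a \<in> pverts G \<and> (b, b') \<in> parcs H"
  by (simp add: box_prod_def)

lemma strong_prod_iff:
  "((a, b), (a', b')) \<in> parcs (G \<boxtimes> H) \<longleftrightarrow>
     (a, a') \<in> parcs G \<and> b = b' \<and> b \<in> pverts H \<or>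
     a = a' \<and> a \<in> pverts G \<and> (b, b') \<in> parcs H \<or>
     (a, a') \<in> parcs G \<and> (b, b') \<in> parcs H"
  by (simp add: strong_prod_def box_prod_def)

lemma pverts_factors [simp]:
  "pverts int_path = UNIV" "pverts (nat_path h) = {1..h}"
  "pverts (G \<box> H) = pverts G \<times> pverts H" "pverts (G \<boxtimes> H) = pverts G \<times> pverts H"
  by (simp_all add: int_path_def nat_path_def box_prod_def strong_prod_def)

lemma pverts_G1: "pverts (G1 h) = UNIV \<times> {1..h}"
  and pverts_G2: "pverts (G2 h) = UNIV \<times> {1..h}"
  by (simp_all add: G1_def G2_def)

lemma parcs_G1_iff:
  "(((x, y), k), ((x', y'), k')) \<in> parcs (G1 h) \<longleftrightarrow>
     k \<in> {1..h} \<and> k' \<in> {1..h} \<and>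
     (\<bar>x - x'\<bar> + \<bar>y - y'\<bar> = 1 \<and> k = k' \<or> x = x' \<and> y = y' \<and> \<bar>int k - int k'\<bar> = 1)"
proof -
  have "\<bar>x - x'\<bar> = 1 \<and> y = y' \<or> x = x' \<and> \<bar>y - y'\<bar> = 1 \<longleftrightarrow> \<bar>x - x'\<bar> + \<bar>y - y'\<bar> = 1"
    by linarith
  then show ?thesis
    by (simp add: G1_def box_prod_iff int_path_iff nat_path_iff) blast
qed

lemma parcs_G2_iff:
  "(((x, y), k), ((x', y'), k')) \<in> parcs (G2 h) \<longleftrightarrow>
     k \<in> {1..h} \<and> k' \<in> {1..h} \<and>
     (max \<bar>x - x'\<bar> \<bar>y - y'\<bar> = 1 \<and> k = k' \<or> x = x' \<and> y = y' \<and> \<bar>int k - int k'\<bar> = 1)"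
proof -
  have "\<bar>x - x'\<bar> = 1 \<and> y = y' \<or> x = x' \<and> \<bar>y - y'\<bar> = 1 \<or> \<bar>x - x'\<bar> = 1 \<and> \<bar>y - y'\<bar> = 1 \<longleftrightarrow>
      max \<bar>x - x'\<bar> \<bar>y - y'\<bar> = 1"
    by linarith
  then show ?thesis
    by (simp add: G2_def box_prod_iff strong_prod_iff int_path_iff nat_path_iff) blast
qed


text \<open>
  A strategy is the sequence \<open>P\<close> of vertex sets protected at turns \<open>1, 2, \<dots>\<close>; the value \<open>P 0\<close>
  is never used. The fire spreads deterministically, so a strategy reacting to the state of the
  game is no more general than such a sequence.
\<close>

definition protected_upto :: "(nat \<Rightarrow> 'a set) \<Rightarrow> nat \<Rightarrow> 'a set" where
  "protected_upto P t = (\<Union>s\<in>{1..t}. P s)"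

primrec burning :: "'a pair_pre_digraph \<Rightarrow> 'a set \<Rightarrow> (nat \<Rightarrow> 'a set) \<Rightarrow> nat \<Rightarrow> 'a set" where
  "burning G B0 P 0 = B0"
| "burning G B0 P (Suc t) = burning G B0 P t \<union>
     {v \<in> pverts G. v \<notin> protected_upto P (Suc t) \<and> (\<exists>u \<in> burning G B0 P t. (u, v) \<in> parcs G)}"

definition legal_strategy ::
    "'a pair_pre_digraph \<Rightarrow> (nat \<Rightarrow> real) \<Rightarrow> 'a set \<Rightarrow> (nat \<Rightarrow> 'a set) \<Rightarrow> bool" where
  "legal_strategy G f B0 P \<longleftrightarrow>
     (\<forall>t\<ge>1. finite (P t) \<and> P t \<subseteq> pverts G - burning G B0 P (t - 1) \<and>
            real (card (protected_upto P t)) \<le> f t)"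

definition contains_fire :: "'a pair_pre_digraph \<Rightarrow> 'a set \<Rightarrow> (nat \<Rightarrow> 'a set) \<Rightarrow> bool" where
  "contains_fire G B0 P \<longleftrightarrow> (\<exists>T. \<forall>t\<ge>T. burning G B0 P (Suc t) = burning G B0 P t)"

definition containable :: "'a pair_pre_digraph \<Rightarrow> (nat \<Rightarrow> real) \<Rightarrow> 'a set \<Rightarrow> bool" where
  "containable G f B0 \<longleftrightarrow> (\<exists>P. legal_strategy G f B0 P \<and> contains_fire G B0 P)"

definition is_critical_protection_rate :: "'a pair_pre_digraph \<Rightarrow> real \<Rightarrow> bool" where
  "is_critical_protection_rate G c \<longleftrightarrow> 0 \<le> c \<and>
     (\<exists>B0. finite B0 \<and> B0 \<subseteq> pverts G \<and> \<not> containable G (\<lambda>t. c * real t) B0) \<and>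
     (\<forall>\<epsilon>>0. \<forall>B0. finite B0 \<and> B0 \<subseteq> pverts G \<longrightarrow> containable G (\<lambda>t. (c + \<epsilon>) * real t) B0)"

text \<open>The property determines \<open>c\<close>, so it is meaningful to speak of the critical protection rate.\<close>

lemma is_critical_protection_rate_unique:
  assumes "is_critical_protection_rate G c" "is_critical_protection_rate G d"
  shows "c = d"
proof -
  have le: "b \<le> a"
    if a: "is_critical_protection_rate G a" and b: "is_critical_protection_rate G b" for a b
  proof (rule ccontr)
    assume "\<not> b \<le> a"
    then have "b - a > 0" by simp
    with a have "\<forall>B0. finite B0 \<and> B0 \<subseteq> pverts G \<longrightarrow> containable G (\<lambda>t. (a + (b - a)) * real t) B0"
      unfolding is_critical_protection_rate_def by blast
    with b show False
      unfolding is_critical_protection_rate_def by auto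
  qed
  show ?thesis using le[OF assms] le[OF assms(2,1)] by simp
qed

end

(*
Change coordinates so that horizontal adjacency is max(|dx|,|dy|) = 1 (for q = 1 take (x+y, x-y)).
Then the fire started from a large box fills boxes whose four sides move outwards at speed one.

Above the critical rate, a fixed rectangle with very unequal distances to its four sides can be
fenced in time: fence cells at distance n + t from the centre are protected at turn t, and before
the farthest side is reached at most three sides are being extended.

At the critical rate, let the energy of a box be the number of burning cells on its boundary plus
the number of protected cells in it. Advancing a side all of whose layers meet the fire raises the
energy by q h. A side that cannot advance either yields a large surplus of energy within h + 1 turns,
in which case one skips ahead, or it is blocked by about as many protected cells outside the box as
the side has burning cells. Two blocked sides at the same time would require more protected cells
than the budget allows: for adjacent sides the energy shows this directly, for opposite sides one
averages it with a second energy that also counts the wall left by earlier blockades of the other two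
sides. Hence at every turn at least three sides advance, and the fire is not contained.
*)

theory Submission
  imports Defs
begin

subsection \<open>Sides of a box in the integer grid\<close>

text \<open>At exactly the critical rate no turn leaves slack, so a loss in every turn, however
  small, would ruin the argument. The only reserve is the head start: about \<open>4 * Q * n\<close>
  for a starting square of radius \<open>n\<close>, where \<open>Q = q * h\<close>. All errors must
  stay below a constant in total or be repaid when they arise; this dictates the treatment of
  corners and the size of the surplus demanded before skipping ahead. The factor 3/2 arises as
  follows. A ring of half-perimeter \<open>p\<close> has about \<open>Q * p\<close> sites, and two
  adjacent sides carry about half of them. With three sides advancing per turn, \<open>p\<close> is
  about \<open>4 * n + 3 * s\<close> at time \<open>s\<close>, and the energy is at least
  \<open>Q * p\<close>. If two adjacent sides are walled, the energy not sitting on the other two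
  must be matched by protected cells, about \<open>Q * p / 2\<close> of them, which beats the budget
  \<open>3 / 2 * Q * s\<close> by the head start. For \<open>h > 1\<close> the obstacle is that a
  side can fail to advance because of a single layer while the others still burn freely. Vertical
  spread into that layer either produces the surplus or forces walls in every layer.\<close>

datatype dir = East | West | North | South

lemma UNIV_dir: "(UNIV :: dir set) = {East, West, North, South}"
  using dir.exhaust by auto

instance dir :: finite
  by standard (simp add: UNIV_dir)

fun opp :: "dir \<Rightarrow> dir" where
  "opp East = West" | "opp West = East" | "opp North = South" | "opp South = North"

text \<open>The first number is the signed distance from the origin in direction \<open>d\<close>,
  so moving outwards always increases it and one argument serves all four sides.\<close>

fun cell :: "dir \<Rightarrow> int \<Rightarrow> int \<Rightarrow> int \<times> int" where
  "cell East r x = (r, x)"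
| "cell West r x = (- r, x)"
| "cell North r x = (x, r)"
| "cell South r x = (x, - r)"

lemma cell_eq_iff [simp]: "cell d r x = cell d r' x' \<longleftrightarrow> r = r' \<and> x = x'"
  by (cases d) auto

text \<open>Sideways offsets that accompany one unit outwards in the max-norm coordinates. For
  \<open>q = 1\<close> the horizontal neighbours become the four diagonal ones, so the offset 0 is
  absent.\<close>

definition steps :: "nat \<Rightarrow> int set" where
  "steps q = {-1, 1} \<union> (if q = 2 then {0} else {})"

definition seg :: "dir \<Rightarrow> int \<Rightarrow> int \<Rightarrow> int \<Rightarrow> ((int \<times> int) \<times> nat) set" where
  "seg d r l u = {(cell d r x, k) | x k. l \<le> x \<and> x \<le> u}"

lemma cell_in_seg [simp]: "(cell d r x, k) \<in> seg d r' l u \<longleftrightarrow> r = r' \<and> l \<le> x \<and> x \<le> u"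
  by (auto simp: seg_def)

text \<open>
  Omitting the end points of the interval on the left-hand side is what makes the corners of a box
  harmless: a corner is either replaced by new cells or stays on the boundary of the larger box.
\<close>

lemma neighbours_in_interval:
  fixes V :: "int set"
  assumes q: "q = 1 \<or> q = 2" and fin: "finite V" and ne: "V \<noteq> {}"
    and V: "V \<subseteq> {l..u}" and lu: "l < u"
  shows "card (V \<inter> {l<..<u}) + q \<le> card {x. l \<le> x \<and> x \<le> u \<and> (\<exists>y\<in>V. x - y \<in> steps q)}"
    (is "_ \<le> card ?N")
proof -
  have finN: "finite ?N" by (rule finite_subset[of _ "{l..u}"]) auto
  define U where "U = V \<inter> {l<..<u}"
  have finU: "finite U" using fin by (simp add: U_def)
  show ?thesis
  proof (cases "U = {}")
    case True
    obtain y where y: "y \<in> V" using ne by blast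
    have yl: "y = l \<or> y = u"
    proof (rule ccontr)
      assume "\<not> (y = l \<or> y = u)"
      with y V have "y \<in> U" by (auto simp: U_def less_le)
      with True show False by simp
    qed
    \<comment> \<open>\<open>V\<close> has only end points here, so just \<open>q\<close> points are
      required; the neighbour of an end point towards the interior lies in the interval because
      \<open>l < u\<close>.\<close>
    define z where "z = (if y = l then l + 1 else u - 1)"
    have z: "z \<noteq> y" "z - y \<in> {-1, 1}" "l \<le> z" "z \<le> u" "l \<le> y" "y \<le> u"
      using yl lu by (auto simp: z_def)
    let ?A = "if q = 2 then {z, y} else {z}"
    have "?A \<subseteq> ?N" using y z by (auto simp: steps_def)
    then have "card ?A \<le> card ?N" using finN by (rule card_mono[rotated])
    moreover have "card ?A = q" using q z by auto
    ultimately show ?thesis using True by (simp add: U_def)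
  next
    case False
    define m where "m = Max U"
    have mU: "m \<in> U" and le: "\<And>x. x \<in> U \<Longrightarrow> x \<le> m"
      using finU False by (auto simp: m_def)
    \<comment> \<open>The left shift of \<open>U\<close> has as many points as \<open>U\<close>, all
      below \<open>m\<close>; the largest element \<open>m\<close> then supplies \<open>q\<close>
      further points at or above \<open>m\<close>.\<close>
    let ?A = "(\<lambda>x. x - 1) ` U" and ?C = "if q = 2 then {m, m + 1} else {m + 1}"
    have "?A \<union> ?C \<subseteq> ?N"
    proof
      fix x assume "x \<in> ?A \<union> ?C"
      then obtain y where y: "y \<in> U" "x - y \<in> steps q"
        using mU by (fastforce simp: steps_def split: if_splits)
      then have "l < y" "y < u" "y \<in> V" by (auto simp: U_def)
      moreover have "\<bar>x - y\<bar> \<le> 1" using y(2) by (auto simp: steps_def split: if_splits)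
      ultimately show "x \<in> ?N" using y by auto
    qed
    then have "card (?A \<union> ?C) \<le> card ?N" using finN by (rule card_mono[rotated])
    moreover have "card (?A \<union> ?C) = card ?A + card ?C"
      using finU by (intro card_Un_disjoint) (auto dest: le)
    moreover have "card ?A = card U" by (intro card_image) (simp add: inj_on_def)
    moreover have "card ?C = q" using q by auto
    ultimately show ?thesis by (simp add: U_def)
  qed
qed

section \<open>Lines of cells across the layers, and how fire crosses them\<close>

lemma card_seg:
  fixes h :: nat
  assumes "finite C" and lay: "\<And>c k. (c, k) \<in> C \<Longrightarrow> k \<in> {1..h}"
  shows "card (C \<inter> seg d r l u) = (\<Sum>k\<in>{1..h}. card {x. l \<le> x \<and> x \<le> u \<and> (cell d r x, k) \<in> C})"
proof -
  let ?X = "\<lambda>k. {x. l \<le> x \<and> x \<le> u \<and> (cell d r x, k) \<in> C}"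
  have fin: "finite (?X k)" for k by (rule finite_subset[of _ "{l..u}"]) auto
  have "C \<inter> seg d r l u = (\<Union>k\<in>{1..h}. (\<lambda>x. (cell d r x, k)) ` ?X k)"
  proof (intro equalityI subsetI)
    fix p assume "p \<in> C \<inter> seg d r l u"
    then obtain x k where "p = (cell d r x, k)" "l \<le> x" "x \<le> u" "p \<in> C"
      by (auto simp: seg_def)
    then show "p \<in> (\<Union>k\<in>{1..h}. (\<lambda>x. (cell d r x, k)) ` ?X k)"
      using lay by (intro UN_I[of k] image_eqI[of _ _ x]) auto
  qed auto
  also have "card \<dots> = (\<Sum>k\<in>{1..h}. card ((\<lambda>x. (cell d r x, k)) ` ?X k))"
    using fin by (intro card_UN_disjoint) auto
  also have "\<dots> = (\<Sum>k\<in>{1..h}. card (?X k))"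
    by (intro sum.cong refl card_image) (auto simp: inj_on_def)
  finally show ?thesis .
qed

text \<open>The fire in max-norm coordinates. \<open>P t\<close> is cumulative, in contrast to a
  strategy, which lists the cells of one turn. For \<open>q = 1\<close> the fire lives on the
  sublattice given by \<open>parity\<close>, which halves the number of sites on a line.\<close>

locale slab_fire =
  fixes q h :: nat and B P :: "nat \<Rightarrow> ((int \<times> int) \<times> nat) set"
  assumes q: "q = 1 \<or> q = 2" and h: "h \<ge> 1"
    and finite_B: "finite (B t)" and finite_P: "finite (P t)"
    and B_Suc: "B t \<subseteq> B (Suc t)" and P_Suc: "P t \<subseteq> P (Suc t)"
    and layer_B: "(c, k) \<in> B t \<Longrightarrow> k \<in> {1..h}"
    and layer_P: "(c, k) \<in> P t \<Longrightarrow> k \<in> {1..h}"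
    and spread: "(cell d r x, k) \<in> B t \<Longrightarrow> \<delta> \<in> steps q \<Longrightarrow>
        (cell d (r + 1) (x + \<delta>), k) \<in> B (Suc t) \<union> P (Suc t)"
    and spread_vertical: "(c, k) \<in> B t \<Longrightarrow> j \<in> {1..h} \<Longrightarrow> \<bar>int j - int k\<bar> = 1 \<Longrightarrow>
        (c, j) \<in> B (Suc t) \<union> P (Suc t)"
    and parity: "q = 1 \<Longrightarrow> ((u, v), k) \<in> B t \<Longrightarrow> even (u + v)"
begin

lemma B_mono: "s \<le> t \<Longrightarrow> B s \<subseteq> B t"
  using B_Suc by (rule lift_Suc_mono_le)

lemma P_mono: "s \<le> t \<Longrightarrow> P s \<subseteq> P t"
  using P_Suc by (rule lift_Suc_mono_le)

definition full :: "nat \<Rightarrow> dir \<Rightarrow> int \<Rightarrow> int \<Rightarrow> int \<Rightarrow> bool" where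
  "full s d r l u \<longleftrightarrow> (\<forall>k\<in>{1..h}. \<exists>x. l \<le> x \<and> x \<le> u \<and> (cell d r x, k) \<in> B s)"

text \<open>Each layer that meets the line gains \<open>q\<close> sites on the next line, and the
  gains are summed over the layers; a layer without fire would gain nothing, hence
  \<open>full\<close>. The second interval is separate so that the new line may be longer than the
  old one when the neighbouring sides advance too.\<close>

lemma advance_line:
  assumes "full s d r l u" and "l1 \<le> l" "u \<le> u1" "l1 < u1"
  shows "card (B s \<inter> seg d r l u \<inter> seg d r (l1 + 1) (u1 - 1)) + q * h
    \<le> card (B (Suc s) \<inter> seg d (r + 1) l1 u1) + card (P (Suc s) \<inter> seg d (r + 1) l1 u1)"
proof -
  let ?V = "\<lambda>k. {x. l \<le> x \<and> x \<le> u \<and> (cell d r x, k) \<in> B s}"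
  let ?N = "\<lambda>k. {x. l1 \<le> x \<and> x \<le> u1 \<and> (\<exists>y\<in>?V k. x - y \<in> steps q)}"
  let ?C = "B (Suc s) \<union> P (Suc s)"
  have "card (B s \<inter> seg d r l u \<inter> seg d r (l1 + 1) (u1 - 1)) + q * h
      = card (B s \<inter> seg d r l u \<inter> seg d r (l1 + 1) (u1 - 1)) + (\<Sum>k\<in>{1..h}. q)"
    by simp
  also have "\<dots> = (\<Sum>k\<in>{1..h}. card {x. l1 + 1 \<le> x \<and> x \<le> u1 - 1 \<and> (cell d r x, k) \<in> B s \<inter> seg d r l u} + q)"
    unfolding sum.distrib using finite_B layer_B by (subst card_seg[where h = h]) auto
  also have "\<dots> \<le> (\<Sum>k\<in>{1..h}. card (?N k))"
  proof (rule sum_mono)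
    fix k assume k: "k \<in> {1..h}"
    have "{x. l1 + 1 \<le> x \<and> x \<le> u1 - 1 \<and> (cell d r x, k) \<in> B s \<inter> seg d r l u} = ?V k \<inter> {l1<..<u1}"
      by auto
    moreover have "card (?V k \<inter> {l1<..<u1}) + q \<le> card (?N k)"
      using assms k by (intro neighbours_in_interval q finite_subset[of "?V k" "{l..u}"])
        (auto simp: full_def)
    ultimately show "card {x. l1 + 1 \<le> x \<and> x \<le> u1 - 1 \<and> (cell d r x, k) \<in> B s \<inter> seg d r l u} + q \<le> card (?N k)"
      by simp
  qed
  also have "\<dots> \<le> (\<Sum>k\<in>{1..h}. card {x. l1 \<le> x \<and> x \<le> u1 \<and> (cell d (r + 1) x, k) \<in> ?C})"
  proof (intro sum_mono card_mono)
    fix k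
    show "finite {x. l1 \<le> x \<and> x \<le> u1 \<and> (cell d (r + 1) x, k) \<in> ?C}"
      by (rule finite_subset[of _ "{l1..u1}"]) auto
    show "?N k \<subseteq> {x. l1 \<le> x \<and> x \<le> u1 \<and> (cell d (r + 1) x, k) \<in> ?C}"
      using spread[of d r _ k s] by force
  qed
  also have "\<dots> = card (?C \<inter> seg d (r + 1) l1 u1)"
    using finite_B finite_P layer_B layer_P by (subst card_seg[where h = h]) auto
  also have "\<dots> \<le> card (B (Suc s) \<inter> seg d (r + 1) l1 u1) + card (P (Suc s) \<inter> seg d (r + 1) l1 u1)"
    unfolding Int_Un_distrib2 by (rule card_Un_le)
  finally show ?thesis .
qed

text \<open>
  The front is followed layer by layer along one fixed diagonal direction. If no line collects a
  surplus, vertical spread forces the surviving part of a layer to be hardly larger than that of an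
  adjacent layer one line earlier, so after \<open>h\<close> lines an empty layer has emptied all the others.
\<close>

lemma wall_or_surplus:
  assumes k0: "k0 \<in> {1..h}" and empty: "\<And>x. l \<le> x \<Longrightarrow> x \<le> u \<Longrightarrow> (cell d r x, k0) \<notin> B s"
    and no_surplus: "\<And>i. i \<in> {1..h} \<Longrightarrow>
      card (B (s + h + 1) \<inter> seg d (r + int i) l u) + (\<Sum>j\<in>{1..i}. card (P (s + h + 1) \<inter> seg d (r + int j) l u))
        < card (B s \<inter> seg d r l u) + \<beta>"
  shows "card (B s \<inter> seg d r l u)
    \<le> (\<Sum>j\<in>{1..h}. card (P (s + h + 1) \<inter> seg d (r + int j) l u)) + h * h * (h * h + \<beta>) + h * h"
proof -
  \<comment> \<open>Only the offset 1 is followed, which lies in \<open>steps q\<close> for both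
    values of \<open>q\<close>. Sites protected at any time up to \<open>s + h + 1\<close> are
    removed, even those protected after the fire has passed, so that one single protected set enters
    all the counts.\<close>
  define T where "T = rec_nat (\<lambda>k. {x. l \<le> x \<and> x \<le> u \<and> (cell d r x, k) \<in> B s})
    (\<lambda>i Ti k. {x. l \<le> x \<and> x \<le> u \<and> x - 1 \<in> Ti k \<and> (cell d (r + int (Suc i)) x, k) \<notin> P (s + h + 1)})"
  have T_0: "T 0 k = {x. l \<le> x \<and> x \<le> u \<and> (cell d r x, k) \<in> B s}" for k
    by (simp add: T_def)
  have T_Suc: "T (Suc i) k = {x. l \<le> x \<and> x \<le> u \<and> x - 1 \<in> T i k \<and> (cell d (r + int (Suc i)) x, k) \<notin> P (s + h + 1)}"
    for i k by (simp add: T_def)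
  have T_sub: "T i k \<subseteq> {l..u}" for i k
    by (cases i) (auto simp: T_0 T_Suc)
  have finT: "finite (T i k)" for i k
    by (rule finite_subset[OF T_sub]) simp
  have burn: "(cell d (r + int i) x, k) \<in> B (s + i)" if "x \<in> T i k" "i \<le> h" for i x k
    using that
  proof (induction i arbitrary: x)
    case 0
    then show ?case by (simp add: T_0)
  next
    case (Suc i)
    then have "(cell d (r + int i) (x - 1), k) \<in> B (s + i)" by (simp add: T_Suc)
    from spread[OF this, of 1]
    have "(cell d (r + int (Suc i)) x, k) \<in> B (s + Suc i) \<union> P (s + Suc i)"
      by (simp add: steps_def algebra_simps)
    moreover have "P (s + Suc i) \<subseteq> P (s + h + 1)"
      using Suc.prems by (intro P_mono) simp
    ultimately show ?case using Suc.prems by (auto simp: T_Suc)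
  qed
  let ?S = "\<lambda>i k. {x. l \<le> x \<and> x \<le> u \<and> (cell d (r + int i) x, k) \<in> B (s + h + 1)}"
  let ?P = "\<lambda>i k. {x. l \<le> x \<and> x \<le> u \<and> (cell d (r + int i) x, k) \<in> P (s + h + 1)}"
  let ?p = "\<lambda>i. \<Sum>k\<in>{1..h}. card (?P i k)"
  have fin: "finite (?S i k)" "finite (?P i k)" for i k
    by (rule finite_subset[of _ "{l..u}"]; auto)+
  have cS: "card (B (s + h + 1) \<inter> seg d (r + int i) l u) = (\<Sum>k\<in>{1..h}. card (?S i k))" for i
    using finite_B layer_B by (rule card_seg)
  have cP: "card (P (s + h + 1) \<inter> seg d (r + int i) l u) = ?p i" for i
    using finite_P layer_P by (rule card_seg)
  have cW: "card (B s \<inter> seg d r l u) = (\<Sum>k\<in>{1..h}. card (T 0 k))"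
    unfolding T_0 using finite_B layer_B by (rule card_seg)
  \<comment> \<open>The shift pushes only the end point \<open>u\<close> out of the interval. This
    costs one cell per layer and line, the source of the terms \<open>h * i\<close> and finally
    \<open>h * h\<close>.\<close>
  have T_step: "card (T i k) \<le> card (T (Suc i) k) + card (?P (Suc i) k) + 1" for i k
  proof -
    have "T i k \<subseteq> (\<lambda>x. x - 1) ` (T (Suc i) k \<union> ?P (Suc i) k) \<union> {u}"
    proof
      fix x assume x: "x \<in> T i k"
      show "x \<in> (\<lambda>x. x - 1) ` (T (Suc i) k \<union> ?P (Suc i) k) \<union> {u}"
      proof (cases "x = u")
        case False
        have "l \<le> x" "x \<le> u" using x T_sub[of i k] by auto
        then have "x + 1 \<in> T (Suc i) k \<union> ?P (Suc i) k"
          using x False by (auto simp: T_Suc)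
        then show ?thesis by force
      qed simp
    qed
    then have "card (T i k) \<le> card ((\<lambda>x. x - 1) ` (T (Suc i) k \<union> ?P (Suc i) k) \<union> {u})"
      by (rule card_mono[rotated]) (intro finite_UnI finite_imageI finT fin finite.intros)
    also have "\<dots> \<le> card ((\<lambda>x. x - 1) ` (T (Suc i) k \<union> ?P (Suc i) k)) + card {u}"
      by (rule card_Un_le)
    also have "\<dots> \<le> card (T (Suc i) k \<union> ?P (Suc i) k) + 1"
      using card_image_le[OF finite_UnI[OF finT fin(2)], of "\<lambda>x. x - 1" "Suc i" k "Suc i" k] by simp
    also have "\<dots> \<le> card (T (Suc i) k) + card (?P (Suc i) k) + 1"
      by (simp add: card_Un_le)
    finally show ?thesis .
  qed
  have T_anti: "card (T (Suc i) k) \<le> card (T i k)" for i k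
    by (rule card_inj_on_le[of "\<lambda>x. x - 1"]) (auto simp: T_Suc inj_on_def finT)
  have T_S: "T i k \<subseteq> ?S i k" if "i \<le> h" for i k
    using T_sub[of i k] burn[of _ i k] B_mono[of "s + i" "s + h + 1"] that by force
  \<comment> \<open>The diagonal copy on line \<open>Suc i\<close> burns at time
    \<open>s + Suc i\<close>, and the vertical step takes one more turn. For the last line this is
    time \<open>s + h + 1\<close>, which fixes the length of the window.\<close>
  have T_adj: "card (T (Suc i) j) \<le> card (?S (Suc i) k) + card (?P (Suc i) k)"
    if "Suc i \<le> h" "k \<in> {1..h}" "\<bar>int k - int j\<bar> = 1" for i j k
  proof -
    have "T (Suc i) j \<subseteq> ?S (Suc i) k \<union> ?P (Suc i) k"
    proof
      fix x assume x: "x \<in> T (Suc i) j"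
      from spread_vertical[OF burn[OF x that(1)] that(2,3)]
      have "(cell d (r + int (Suc i)) x, k) \<in> B (Suc (s + Suc i)) \<union> P (Suc (s + Suc i))" .
      moreover have "B (Suc (s + Suc i)) \<subseteq> B (s + h + 1)" "P (Suc (s + Suc i)) \<subseteq> P (s + h + 1)"
        using that by (auto intro!: B_mono P_mono)
      ultimately show "x \<in> ?S (Suc i) k \<union> ?P (Suc i) k"
        using x T_sub[of "Suc i" j] by auto
    qed
    then have "card (T (Suc i) j) \<le> card (?S (Suc i) k \<union> ?P (Suc i) k)"
      by (rule card_mono[rotated]) (intro finite_UnI fin)
    then show ?thesis using card_Un_le[of "?S (Suc i) k" "?P (Suc i) k"] by linarith
  qed
  have T_total: "(\<Sum>k\<in>{1..h}. card (T 0 k)) \<le> (\<Sum>k\<in>{1..h}. card (T i k)) + (\<Sum>j\<in>{1..i}. ?p j) + h * i" for i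
  proof (induction i)
    case (Suc i)
    have "(\<Sum>k\<in>{1..h}. card (T i k)) \<le> (\<Sum>k\<in>{1..h}. card (T (Suc i) k) + card (?P (Suc i) k) + 1)"
      by (intro sum_mono T_step)
    also have "\<dots> = (\<Sum>k\<in>{1..h}. card (T (Suc i) k)) + ?p (Suc i) + h"
      by (simp only: sum.distrib) simp
    finally show ?case using Suc.IH by simp
  qed simp
  \<comment> \<open>Without a surplus the burning and protected cells of the whole line are capped.
    The layers other than \<open>k\<close> already use up their share of the cap, up to one cell
    each, and what survives in layer \<open>j\<close> must also be burning or protected in layer
    \<open>k\<close>; so little room is left for it.\<close>
  have decay: "card (T (Suc i) j) \<le> card (T i k) + (h * h + \<beta>)"
    if i: "Suc i \<le> h" and k: "k \<in> {1..h}" and jk: "\<bar>int k - int j\<bar> = 1" for i j k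
  proof -
    have "(\<Sum>k\<in>{1..h}. card (?S (Suc i) k)) + (\<Sum>j\<in>{1..Suc i}. ?p j) < (\<Sum>k\<in>{1..h}. card (T 0 k)) + \<beta>"
      using no_surplus[of "Suc i"] i unfolding cS cP cW by simp
    then have 1: "(\<Sum>k\<in>{1..h}. card (?S (Suc i) k) + card (?P (Suc i) k)) < (\<Sum>k\<in>{1..h}. card (T i k)) + h * i + \<beta>"
      using T_total[of i] by (simp add: sum.distrib)
    have split: "(\<Sum>k\<in>{1..h}. f k) = f k + (\<Sum>k\<in>{1..h} - {k}. f k)" for f :: "nat \<Rightarrow> nat"
      using k by (simp add: sum.remove)
    have "(\<Sum>k\<in>{1..h} - {k}. card (T i k)) \<le> (\<Sum>k\<in>{1..h} - {k}. card (?S (Suc i) k) + card (?P (Suc i) k) + 1)"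
    proof (rule sum_mono)
      fix k' assume "k' \<in> {1..h} - {k}"
      have "card (T (Suc i) k') \<le> card (?S (Suc i) k')"
        using fin(1) T_S[OF i, of k'] by (rule card_mono)
      then show "card (T i k') \<le> card (?S (Suc i) k') + card (?P (Suc i) k') + 1"
        using T_step[of i k'] by linarith
    qed
    also have "\<dots> \<le> (\<Sum>k\<in>{1..h} - {k}. card (?S (Suc i) k) + card (?P (Suc i) k)) + h"
      using card_Diff1_le[of "{1..h}" k] by (simp only: sum.distrib) simp
    finally have "card (T (Suc i) j) < card (T i k) + h * i + h + \<beta>"
      using 1 T_adj[OF i k jk] unfolding split by linarith
    moreover have "h * i + h \<le> h * h"
      using i mult_le_mono2[of "Suc i" h h] by simp
    ultimately show ?thesis by linarith
  qed
  have small: "card (T i k) \<le> i * (h * h + \<beta>)" if "i \<le> h" "k \<in> {1..h}" "\<bar>int k - int k0\<bar> \<le> int i" for i k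
    using that
  proof (induction i arbitrary: k)
    case 0
    then have "T 0 k = {}" using empty by (auto simp: T_0)
    then show ?case by simp
  next
    case (Suc i)
    show ?case
    proof (cases "\<bar>int k - int k0\<bar> \<le> int i")
      case True
      then have "card (T i k) \<le> i * (h * h + \<beta>)" using Suc by simp
      then show ?thesis using T_anti[of i k] by simp
    next
      case False
      define k' where "k' = (if k0 < k then k - 1 else k + 1)"
      have k': "k' \<in> {1..h}" "\<bar>int k' - int k\<bar> = 1" "\<bar>int k' - int k0\<bar> \<le> int i"
        using False Suc.prems k0 by (auto simp: k'_def)
      have "card (T (Suc i) k) \<le> card (T i k') + (h * h + \<beta>)"
        using decay Suc.prems k' by blast
      moreover have "card (T i k') \<le> i * (h * h + \<beta>)"
        using Suc k' by simp
      ultimately show ?thesis by simp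
    qed
  qed
  have "(\<Sum>k\<in>{1..h}. card (T h k)) \<le> (\<Sum>k\<in>{1..h}. h * (h * h + \<beta>))"
    using k0 by (intro sum_mono small) auto
  also have "\<dots> = h * h * (h * h + \<beta>)" by simp
  finally show ?thesis
    using T_total[of h] unfolding cP cW by linarith
qed

end

section \<open>Boxes with their rings, outer zones and strips\<close>

lemma seg_iff [simp]:
  "((x, y), k) \<in> seg East r l u \<longleftrightarrow> x = r \<and> l \<le> y \<and> y \<le> u"
  "((x, y), k) \<in> seg West r l u \<longleftrightarrow> x = - r \<and> l \<le> y \<and> y \<le> u"
  "((x, y), k) \<in> seg North r l u \<longleftrightarrow> y = r \<and> l \<le> x \<and> x \<le> u"
  "((x, y), k) \<in> seg South r l u \<longleftrightarrow> y = - r \<and> l \<le> x \<and> x \<le> u"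
  by (auto simp: seg_def)

fun lo :: "(dir \<Rightarrow> int) \<Rightarrow> dir \<Rightarrow> int" where
  "lo b East = - b South" | "lo b West = - b South" | "lo b North = - b West" | "lo b South = - b West"

fun hi :: "(dir \<Rightarrow> int) \<Rightarrow> dir \<Rightarrow> int" where
  "hi b East = b North" | "hi b West = b North" | "hi b North = b East" | "hi b South = b East"

definition box :: "(dir \<Rightarrow> int) \<Rightarrow> ((int \<times> int) \<times> nat) set" where
  "box b = {((x, y), k) | x y k. - b West \<le> x \<and> x \<le> b East \<and> - b South \<le> y \<and> y \<le> b North}"

lemma box_iff [simp]:
  "((x, y), k) \<in> box b \<longleftrightarrow> - b West \<le> x \<and> x \<le> b East \<and> - b South \<le> y \<and> y \<le> b North"
  by (simp add: box_def)

definition side :: "(dir \<Rightarrow> int) \<Rightarrow> dir \<Rightarrow> ((int \<times> int) \<times> nat) set" where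
  "side b d = seg d (b d) (lo b d) (hi b d)"

definition ring :: "(dir \<Rightarrow> int) \<Rightarrow> ((int \<times> int) \<times> nat) set" where
  "ring b = (\<Union>d. side b d)"

lemma ring_iff:
  "((x, y), k) \<in> ring b \<longleftrightarrow>
    (x = b East \<or> x = - b West) \<and> - b South \<le> y \<and> y \<le> b North \<or>
    (y = b North \<or> y = - b South) \<and> - b West \<le> x \<and> x \<le> b East"
  by (auto simp: ring_def side_def UNIV_dir)

definition zone :: "nat \<Rightarrow> (dir \<Rightarrow> int) \<Rightarrow> dir \<Rightarrow> ((int \<times> int) \<times> nat) set" where
  "zone m b d = (\<Union>j\<in>{1..m}. seg d (b d + int j) (lo b d) (hi b d))"

lemma zone_iff:
  "((x, y), k) \<in> zone m b East \<longleftrightarrow> b East < x \<and> x \<le> b East + m \<and> - b South \<le> y \<and> y \<le> b North"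
  "((x, y), k) \<in> zone m b West \<longleftrightarrow> x < - b West \<and> - b West - m \<le> x \<and> - b South \<le> y \<and> y \<le> b North"
  "((x, y), k) \<in> zone m b North \<longleftrightarrow> b North < y \<and> y \<le> b North + m \<and> - b West \<le> x \<and> x \<le> b East"
  "((x, y), k) \<in> zone m b South \<longleftrightarrow> y < - b South \<and> - b South - m \<le> y \<and> - b West \<le> x \<and> x \<le> b East"
proof -
  have *: "(\<exists>j\<in>{1..m}. z = w + int j) \<longleftrightarrow> w < z \<and> z \<le> w + int m" for z w
  proof
    assume "w < z \<and> z \<le> w + int m"
    then show "\<exists>j\<in>{1..m}. z = w + int j" by (intro bexI[of _ "nat (z - w)"]) auto
  qed auto
  have **: "x = - w - int j \<longleftrightarrow> - x = w + int j" for x w j by auto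
  show "((x, y), k) \<in> zone m b East \<longleftrightarrow> b East < x \<and> x \<le> b East + m \<and> - b South \<le> y \<and> y \<le> b North"
    using *[of x "b East"] by (auto simp: zone_def)
  show "((x, y), k) \<in> zone m b West \<longleftrightarrow> x < - b West \<and> - b West - m \<le> x \<and> - b South \<le> y \<and> y \<le> b North"
    using *[of "- x" "b West"] by (auto simp: zone_def **)
  show "((x, y), k) \<in> zone m b North \<longleftrightarrow> b North < y \<and> y \<le> b North + m \<and> - b West \<le> x \<and> x \<le> b East"
    using *[of y "b North"] by (auto simp: zone_def)
  show "((x, y), k) \<in> zone m b South \<longleftrightarrow> y < - b South \<and> - b South - m \<le> y \<and> - b West \<le> x \<and> x \<le> b East"
    using *[of "- y" "b South"] by (auto simp: zone_def **)
qed

text \<open>The strip is bounded only along the axis of its direction. It therefore contains the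
  zones beyond the two other sides, where their walls stand, and is disjoint from the zones beyond
  its own two sides.\<close>

fun strip :: "(dir \<Rightarrow> int) \<Rightarrow> dir \<Rightarrow> ((int \<times> int) \<times> nat) set" where
  "strip b East = {((x, y), k) | x y k. - b West \<le> x \<and> x \<le> b East}"
| "strip b West = {((x, y), k) | x y k. - b West \<le> x \<and> x \<le> b East}"
| "strip b North = {((x, y), k) | x y k. - b South \<le> y \<and> y \<le> b North}"
| "strip b South = {((x, y), k) | x y k. - b South \<le> y \<and> y \<le> b North}"

definition advance :: "dir set \<Rightarrow> (dir \<Rightarrow> int) \<Rightarrow> dir \<Rightarrow> int" where
  "advance A b = (\<lambda>d. b d + (if d \<in> A then 1 else 0))"

lemma card_pieces_le:
  assumes C: "finite C" and A: "finite A" and D: "D \<subseteq> C" and F: "\<And>d. d \<in> A \<Longrightarrow> F d \<subseteq> C"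
    and disj: "\<And>d d'. d \<in> A \<Longrightarrow> d' \<in> A \<Longrightarrow> d \<noteq> d' \<Longrightarrow> F d \<inter> F d' = {}" "\<And>d. d \<in> A \<Longrightarrow> D \<inter> F d = {}"
  shows "card D + (\<Sum>d\<in>A. card (F d)) \<le> card C"
proof -
  have fin: "finite D" "\<And>d. d \<in> A \<Longrightarrow> finite (F d)"
    using finite_subset[OF D C] finite_subset[OF F C] by auto
  have "(\<Sum>d\<in>A. card (F d)) = card (\<Union>d\<in>A. F d)"
    using A fin disj by (intro card_UN_disjoint[symmetric]) auto
  moreover have "D \<inter> (\<Union>d\<in>A. F d) = {}" using disj(2) by blast
  then have "card D + card (\<Union>d\<in>A. F d) = card (D \<union> (\<Union>d\<in>A. F d))"
    using A fin by (intro card_Un_disjoint[symmetric]) auto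
  moreover have "card (D \<union> (\<Union>d\<in>A. F d)) \<le> card C"
    using C D F by (intro card_mono) auto
  ultimately show ?thesis by simp
qed

lemma sum_dir: "(\<Sum>d\<in>UNIV. f d) = f East + f West + f North + f South" for f :: "dir \<Rightarrow> 'a::comm_monoid_add"
  by (simp add: UNIV_dir add.assoc)

lemma card_zone:
  assumes "finite C"
  shows "card (C \<inter> zone m b d) = (\<Sum>j\<in>{1..m}. card (C \<inter> seg d (b d + int j) (lo b d) (hi b d)))"
proof -
  have "C \<inter> zone m b d = (\<Union>j\<in>{1..m}. C \<inter> seg d (b d + int j) (lo b d) (hi b d))"
    by (auto simp: zone_def)
  also have "card \<dots> = (\<Sum>j\<in>{1..m}. card (C \<inter> seg d (b d + int j) (lo b d) (hi b d)))"
    using assms by (intro card_UN_disjoint) (auto simp: seg_def)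
  finally show ?thesis .
qed

lemma card_box_zones:
  assumes "finite C" and pos: "\<And>d. b d \<ge> 1"
  shows "card (C \<inter> box b) + (\<Sum>d\<in>UNIV. card (C \<inter> zone m b d)) \<le> card C"
proof (rule card_pieces_le)
  have pos': "1 \<le> b East" "1 \<le> b West" "1 \<le> b North" "1 \<le> b South" using pos by auto
  show "(C \<inter> zone m b d) \<inter> (C \<inter> zone m b d') = {}" if "d \<noteq> d'" for d d'
    using that pos' by (cases d; cases d'; auto simp: zone_iff)
  show "(C \<inter> box b) \<inter> (C \<inter> zone m b d) = {}" for d
    using pos' by (cases d; auto simp: zone_iff)
qed (use assms in auto)

lemma card_strip_zones:
  assumes "finite C" and pos: "\<And>d. b d \<ge> 1"
  shows "card (C \<inter> strip b d) + card (C \<inter> zone m b d) + card (C \<inter> zone m b (opp d)) \<le> card C"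
proof -
  have pos': "1 \<le> b East" "1 \<le> b West" "1 \<le> b North" "1 \<le> b South" using pos by auto
  have "card (C \<inter> strip b d) + (\<Sum>e\<in>{d, opp d}. card (C \<inter> zone m b e)) \<le> card C"
  proof (rule card_pieces_le)
    show "(C \<inter> zone m b e) \<inter> (C \<inter> zone m b e') = {}" if "e \<noteq> e'" for e e'
      using that pos' by (cases e; cases e'; auto simp: zone_iff)
    show "(C \<inter> strip b d) \<inter> (C \<inter> zone m b e) = {}" if "e \<in> {d, opp d}" for e
      using that pos' by (cases d; auto simp: zone_iff)
  qed (use assms in auto)
  moreover have "d \<noteq> opp d" by (cases d) auto
  ultimately show ?thesis by simp
qed

context slab_fire
begin

text \<open>Nothing may be lost at the corners. Where two adjacent sides both advance, the new
  corner is given to the North or South line, so the new lines are disjoint. A burning cell of the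
  old ring that is not counted on an advancing line lies on a side that stays, and so remains on the
  ring.\<close>

lemma advance_ring:
  assumes full: "\<And>d. d \<in> A \<Longrightarrow> full s d (b d) (lo b d) (hi b d)" and pos: "\<And>d. b d \<ge> 1"
  shows "card (B s \<inter> ring b) + card (P s \<inter> box b) + card A * (q * h)
    \<le> card (B (Suc s) \<inter> ring (advance A b)) + card (P (Suc s) \<inter> box (advance A b))"
proof -
  let ?b = "advance A b"
  define l where "l = (\<lambda>d. if d \<in> {East, West} then lo b d else lo ?b d)"
  define u where "u = (\<lambda>d. if d \<in> {East, West} then hi b d else hi ?b d)"
  define new where "new = (\<lambda>d. seg d (b d + 1) (l d) (u d))"
  define old where "old = (\<lambda>d. B s \<inter> side b d \<inter> seg d (b d) (l d + 1) (u d - 1))"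
  have pos': "1 \<le> b East" "1 \<le> b West" "1 \<le> b North" "1 \<le> b South" using pos by auto
  have finA: "finite A" by simp
  have lu: "l d \<le> lo b d" "hi b d \<le> u d" "l d < u d" for d
    using pos' by (cases d; auto simp: l_def u_def advance_def)+
  have gain: "card (old d) + q * h \<le> card (B (Suc s) \<inter> new d) + card (P (Suc s) \<inter> new d)" if "d \<in> A" for d
    using advance_line[OF full[OF that] lu] by (simp add: old_def new_def side_def)
  have new_disj: "new d \<inter> new d' = {}" if "d \<noteq> d'" for d d'
    using that pos' by (cases d; cases d'; auto simp: new_def l_def u_def advance_def)
  have new_box: "new d \<inter> box b = {}" for d
    using pos' by (cases d; auto simp: new_def l_def u_def advance_def)
  have new_ring: "new d \<subseteq> ring ?b" if "d \<in> A" for d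
    using that pos' by (cases d; auto simp: new_def l_def u_def advance_def ring_iff)
  have ring_box: "ring b' \<subseteq> box b'" if "\<And>d. b' d \<ge> 1" for b'
    using that[of East] that[of West] that[of North] that[of South] by (auto simp: ring_iff)
  have kept: "B s \<inter> ring b - (\<Union>d\<in>A. old d) \<subseteq> ring ?b"
  proof clarify
    fix x y k
    assume *: "((x, y), k) \<in> B s" "((x, y), k) \<in> ring b" "((x, y), k) \<notin> (\<Union>d\<in>A. old d)"
    have **: "((x, y), k) \<notin> seg d (b d) (lo b d) (hi b d) \<or> ((x, y), k) \<notin> seg d (b d) (l d + 1) (u d - 1)"
      if "d \<in> A" for d
      using that * by (auto simp: old_def side_def)
    have le: "b d \<le> ?b d" "d \<notin> A \<Longrightarrow> ?b d = b d" "d \<in> A \<Longrightarrow> ?b d = b d + 1" for d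
      by (auto simp: advance_def)
    have xy: "- b West \<le> x" "x \<le> b East" "- b South \<le> y" "y \<le> b North"
      using *(2) pos' by (auto simp: ring_iff)
    have xy': "- ?b West \<le> x" "x \<le> ?b East" "- ?b South \<le> y" "y \<le> ?b North"
      using xy le(1)[of East] le(1)[of West] le(1)[of North] le(1)[of South] by linarith+
    have ew: "((x, y), k) \<in> ring ?b" if "x = b East \<and> East \<notin> A \<or> x = - b West \<and> West \<notin> A"
      using that xy' le(2) by (auto simp: ring_iff)
    have ns: "((x, y), k) \<in> ring ?b" if ns: "y = b North \<or> y = - b South"
    proof (cases "y = b North \<and> North \<notin> A \<or> y = - b South \<and> South \<notin> A")
      case True
      then show ?thesis using xy' le(2) by (auto simp: ring_iff)
    next
      case False
      then have "y = b North \<and> North \<in> A \<or> y = - b South \<and> South \<in> A" using ns by blast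
      then have "\<not> (- ?b West + 1 \<le> x \<and> x \<le> ?b East - 1)"
        using **[of North] **[of South] xy by (auto simp: l_def u_def)
      then have "x = b East \<and> East \<notin> A \<or> x = - b West \<and> West \<notin> A"
        using xy le[of East] le[of West] by (cases "East \<in> A"; cases "West \<in> A") auto
      then show ?thesis by (rule ew)
    qed
    show "((x, y), k) \<in> ring ?b"
    proof (cases "y = b North \<or> y = - b South")
      case False
      then have x: "x = b East \<or> x = - b West" "- b South + 1 \<le> y" "y \<le> b North - 1"
        using *(2) xy by (auto simp: ring_iff)
      then have "x = b East \<and> East \<notin> A \<or> x = - b West \<and> West \<notin> A"
        using **[of East] **[of West] xy by (auto simp: l_def u_def)
      then show ?thesis by (rule ew)
    qed (rule ns)
  qed
  let ?kept = "B s \<inter> ring b - (\<Union>d\<in>A. old d)"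
  have "card (B s \<inter> ring b) \<le> card ?kept + (\<Sum>d\<in>A. card (old d))"
  proof -
    have "card (B s \<inter> ring b) \<le> card (?kept \<union> (\<Union>d\<in>A. old d))"
      using finite_B[of s] by (intro card_mono finite_UnI finite_UN_I finA) (auto simp: old_def)
    also have "\<dots> \<le> card ?kept + card (\<Union>d\<in>A. old d)" by (rule card_Un_le)
    finally show ?thesis using card_UN_le[OF finA, of old] by linarith
  qed
  moreover have "card ?kept + (\<Sum>d\<in>A. card (B (Suc s) \<inter> new d)) \<le> card (B (Suc s) \<inter> ring ?b)"
  proof (rule card_pieces_le)
    show "?kept \<subseteq> B (Suc s) \<inter> ring ?b" using kept B_Suc[of s] by blast
    show "B (Suc s) \<inter> new d \<subseteq> B (Suc s) \<inter> ring ?b" if "d \<in> A" for d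
      using new_ring[OF that] by blast
    show "?kept \<inter> (B (Suc s) \<inter> new d) = {}" for d
    proof -
      have "?kept \<subseteq> box b" by (rule order_trans[OF _ ring_box[OF pos]]) auto
      then have "?kept \<inter> new d = {}" using new_box[of d] by (meson disjoint_iff subsetD)
      then show ?thesis by auto
    qed
    show "(B (Suc s) \<inter> new d) \<inter> (B (Suc s) \<inter> new d') = {}" if "d \<noteq> d'" for d d'
      using new_disj[OF that] by blast
  qed (simp_all add: finite_B)
  moreover have "card (P s \<inter> box b) + (\<Sum>d\<in>A. card (P (Suc s) \<inter> new d)) \<le> card (P (Suc s) \<inter> box ?b)"
  proof (rule card_pieces_le)
    have "box b \<subseteq> box ?b" by (auto simp: advance_def)
    then show "P s \<inter> box b \<subseteq> P (Suc s) \<inter> box ?b" using P_Suc[of s] by blast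
    have "ring ?b \<subseteq> box ?b"
      using pos by (intro ring_box) (simp add: advance_def add_increasing2)
    then show "P (Suc s) \<inter> new d \<subseteq> P (Suc s) \<inter> box ?b" if "d \<in> A" for d
      using new_ring[OF that] by blast
    show "(P s \<inter> box b) \<inter> (P (Suc s) \<inter> new d) = {}" for d
      using new_box[of d] by blast
    show "(P (Suc s) \<inter> new d) \<inter> (P (Suc s) \<inter> new d') = {}" if "d \<noteq> d'" for d d'
      using new_disj[OF that] by blast
  qed (simp_all add: finite_P)
  moreover have "(\<Sum>d\<in>A. card (old d)) + card A * (q * h)
      \<le> (\<Sum>d\<in>A. card (B (Suc s) \<inter> new d)) + (\<Sum>d\<in>A. card (P (Suc s) \<inter> new d))"
    using sum_mono[OF gain, of A] by (simp add: sum.distrib)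
  ultimately show ?thesis by linarith
qed

end

subsection \<open>Energies of a box\<close>

lemma lo_le_hi: "(\<And>d. b d \<ge> 1) \<Longrightarrow> lo b d + 1 \<le> hi b d"
  using add_mono[of 1 "b East" 1 "b West"] add_mono[of 1 "b North" 1 "b South"] by (cases d) auto

lemma opp_opp [simp]: "opp (opp d) = d"
  by (cases d) auto

lemma opp_neq [simp]: "opp d \<noteq> d" "d \<noteq> opp d"
  by (cases d; simp)+

lemma card_seg_point_le:
  assumes "finite C" and "\<And>c k. (c, k) \<in> C \<Longrightarrow> k \<in> {1..h}"
  shows "card (C \<inter> seg d r x x) \<le> h"
proof -
  have "C \<inter> seg d r x x \<subseteq> (\<lambda>k. (cell d r x, k)) ` {1..h}"
  proof
    fix p assume p: "p \<in> C \<inter> seg d r x x"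
    then obtain k where "p = (cell d r x, k)" by (auto simp: seg_def)
    with p assms(2) show "p \<in> (\<lambda>k. (cell d r x, k)) ` {1..h}" by blast
  qed
  then have "card (C \<inter> seg d r x x) \<le> card ((\<lambda>k. (cell d r x, k)) ` {1..h})"
    by (rule card_mono[rotated]) simp
  also have "\<dots> \<le> card {1..h}" by (rule card_image_le) simp
  finally show ?thesis by simp
qed

lemma side_mono:
  assumes "b' d = b d" "\<And>e. b e \<le> b' e"
  shows "side b d \<subseteq> side b' d"
  using assms(1) assms(2)[of East] assms(2)[of West] assms(2)[of North] assms(2)[of South]
  by (cases d) (auto simp: side_def)

context slab_fire
begin

definition width :: "nat \<Rightarrow> (dir \<Rightarrow> int) \<Rightarrow> dir \<Rightarrow> nat" where
  "width s b d = card (B s \<inter> side b d)"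

definition energy :: "nat \<Rightarrow> (dir \<Rightarrow> int) \<Rightarrow> nat" where
  "energy s b = card (B s \<inter> ring b) + card (P s \<inter> box b)"

text \<open>Protected cells are counted \<open>h + 1\<close> turns ahead because a wall is certified
  only by the cells protected up to then, and \<open>axis_energy_restart\<close> must include such a
  wall at once.\<close>

definition axis_energy :: "nat \<Rightarrow> (dir \<Rightarrow> int) \<Rightarrow> dir \<Rightarrow> nat" where
  "axis_energy s b d = card (P (s + h + 1) \<inter> strip b d) + width s b d + width s b (opp d)"

definition full_side :: "nat \<Rightarrow> (dir \<Rightarrow> int) \<Rightarrow> dir \<Rightarrow> bool" where
  "full_side s b d \<longleftrightarrow> full s d (b d) (lo b d) (hi b d)"

text \<open>What is won by letting \<open>h + 1\<close> turns pass and moving side \<open>d\<close>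
  out by \<open>i\<close> lines: the burning cells found there and the protected cells passed over
  replace the old side with a profit of \<beta>.\<close>

definition surplus :: "nat \<Rightarrow> nat \<Rightarrow> (dir \<Rightarrow> int) \<Rightarrow> dir \<Rightarrow> nat \<Rightarrow> bool" where
  "surplus \<beta> s b d i \<longleftrightarrow> width s b d + \<beta>
     \<le> width (s + h + 1) (b(d := b d + int i)) d + card (P (s + h + 1) \<inter> zone i b d)"

lemma lo_hi_upd [simp]: "lo (b(d := r)) d = lo b d" "hi (b(d := r)) d = hi b d"
  by (cases d; simp)+

lemma wall_if_no_surplus:
  assumes "\<not> full_side s b d" and "\<And>i. i \<in> {1..h} \<Longrightarrow> \<not> surplus \<beta> s b d i"
  shows "width s b d \<le> card (P (s + h + 1) \<inter> zone h b d) + (h * h * (h * h + \<beta>) + h * h)"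
proof -
  obtain k0 where "k0 \<in> {1..h}" "\<And>x. lo b d \<le> x \<Longrightarrow> x \<le> hi b d \<Longrightarrow> (cell d (b d) x, k0) \<notin> B s"
    using assms(1) by (auto simp: full_side_def full_def)
  then have "card (B s \<inter> seg d (b d) (lo b d) (hi b d))
    \<le> (\<Sum>j\<in>{1..h}. card (P (s + h + 1) \<inter> seg d (b d + int j) (lo b d) (hi b d))) + h * h * (h * h + \<beta>) + h * h"
  proof (rule wall_or_surplus)
    fix i assume "i \<in> {1..h}"
    from assms(2)[OF this]
    show "card (B (s + h + 1) \<inter> seg d (b d + int i) (lo b d) (hi b d))
        + (\<Sum>j\<in>{1..i}. card (P (s + h + 1) \<inter> seg d (b d + int j) (lo b d) (hi b d)))
        < card (B s \<inter> seg d (b d) (lo b d) (hi b d)) + \<beta>"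
      unfolding surplus_def width_def card_zone[OF finite_P] by (simp add: side_def)
  qed
  then show ?thesis
    unfolding width_def side_def card_zone[OF finite_P] by simp
qed

lemma energy_advance:
  assumes "\<And>d. d \<in> A \<Longrightarrow> full_side s b d" and "\<And>d. b d \<ge> 1"
  shows "energy s b + card A * (q * h) \<le> energy (Suc s) (advance A b)"
  using advance_ring[of A s b] assms by (simp add: energy_def full_side_def)

text \<open>Only side \<open>d\<close> moves; the other three stay put although \<open>h + 1\<close>
  turns pass. Ring cells off side \<open>d\<close> remain on the new ring, and the protected cells
  in the lines passed over enter the box.\<close>

lemma energy_jump:
  assumes sp: "surplus \<beta> s b d i" and i: "i \<ge> 1" and pos: "\<And>d. b d \<ge> 1"
  shows "energy s b + \<beta> \<le> energy (s + h + 1) (b(d := b d + int i))"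
proof -
  let ?b = "b(d := b d + int i)" and ?s = "s + h + 1"
  have pos': "1 \<le> b East" "1 \<le> b West" "1 \<le> b North" "1 \<le> b South" using pos by auto
  have BB: "B s \<subseteq> B ?s" and PP: "P s \<subseteq> P ?s" by (auto intro!: B_mono P_mono)
  have "card (B s \<inter> ring b) \<le> card (B s \<inter> ring b - side b d) + card (B s \<inter> side b d)"
    by (rule order_trans[OF card_mono card_Un_le]) (auto simp: finite_B)
  moreover have "card (B s \<inter> ring b - side b d) + card (B ?s \<inter> side ?b d) \<le> card (B ?s \<inter> ring ?b)"
  proof -
    have "ring b - side b d \<subseteq> ring ?b"
      using i pos' by (cases d; auto simp: ring_iff side_def)
    moreover have "(ring b - side b d) \<inter> side ?b d = {}"
      using i pos' by (cases d; auto simp: ring_iff side_def)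
    moreover have "side ?b d \<subseteq> ring ?b" by (auto simp: ring_def)
    ultimately have "card (B s \<inter> ring b - side b d) + (\<Sum>d\<in>{d}. card (B ?s \<inter> side ?b d)) \<le> card (B ?s \<inter> ring ?b)"
      using BB by (intro card_pieces_le) (auto simp: finite_B)
    then show ?thesis by simp
  qed
  moreover have "card (P s \<inter> box b) + card (P ?s \<inter> zone i b d) \<le> card (P ?s \<inter> box ?b)"
  proof -
    have "box b \<subseteq> box ?b" "zone i b d \<subseteq> box ?b" "box b \<inter> zone i b d = {}"
      using pos' by (cases d; auto simp: zone_iff)+
    then have "card (P s \<inter> box b) + (\<Sum>d\<in>{d}. card (P ?s \<inter> zone i b d)) \<le> card (P ?s \<inter> box ?b)"
      using PP by (intro card_pieces_le) (auto simp: finite_P)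
    then show ?thesis by simp
  qed
  ultimately show ?thesis
    using sp unfolding energy_def surplus_def width_def by linarith
qed

lemma axis_energy_jump:
  assumes sp: "surplus \<beta> s b e i" and i: "i \<ge> 1" and pos: "\<And>d. b d \<ge> 1"
  shows "axis_energy s b d + (if e \<in> {d, opp d} then \<beta> else 0) \<le> axis_energy (s + h + 1) (b(e := b e + int i)) d"
proof -
  let ?b = "b(e := b e + int i)" and ?s = "s + h + 1"
  have BB: "B s \<subseteq> B ?s" and PP: "P (s + h + 1) \<subseteq> P (?s + h + 1)" by (auto intro!: B_mono P_mono)
  have mono: "width s b d' \<le> width ?s ?b d'" if "d' \<noteq> e" for d'
  proof -
    have "side b d' \<subseteq> side ?b d'" using that by (intro side_mono) auto
    then show ?thesis unfolding width_def using BB by (intro card_mono) (auto simp: finite_B)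
  qed
  show ?thesis
  proof (cases "e \<in> {d, opp d}")
    case False
    then have "strip b d = strip ?b d" by (cases d; cases e; simp)
    then have "card (P (s + h + 1) \<inter> strip b d) \<le> card (P (?s + h + 1) \<inter> strip ?b d)"
      using PP by (intro card_mono) (auto simp: finite_P)
    then show ?thesis using False mono[of d] mono[of "opp d"] unfolding axis_energy_def by auto
  next
    case True
    have "strip b d \<subseteq> strip ?b d" "zone i b e \<subseteq> strip ?b d" "strip b d \<inter> zone i b e = {}"
      using True pos[of East] pos[of West] pos[of North] pos[of South]
      by (cases d; cases e; auto simp: zone_iff)+
    then have "card (P (s + h + 1) \<inter> strip b d) + (\<Sum>e\<in>{e}. card (P (s + h + 1) \<inter> zone i b e))
        \<le> card (P (?s + h + 1) \<inter> strip ?b d)"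
      using PP by (intro card_pieces_le) (auto simp: finite_P)
    then have "card (P (s + h + 1) \<inter> strip b d) + card (P (s + h + 1) \<inter> zone i b e)
        \<le> card (P (?s + h + 1) \<inter> strip ?b d)" by simp
    moreover have "width s b d + width s b (opp d) + \<beta> \<le>
      width ?s ?b d + width ?s ?b (opp d) + card (P (s + h + 1) \<inter> zone i b e)"
      using True
    proof
      assume "e = d"
      with sp mono[of "opp d"] show ?thesis unfolding surplus_def by simp
    next
      assume "e \<in> {opp d}"
      with sp mono[of "d"] show ?thesis unfolding surplus_def by simp
    qed
    ultimately show ?thesis using True unfolding axis_energy_def by simp
  qed
qed

text \<open>When both perpendicular sides advance, the new line overhangs the old one by one
  position at either end and no old cell is lost. Otherwise the two end columns, of at most
  \<open>h\<close> cells each, are given up.\<close>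

lemma side_advance:
  assumes full: "full_side s b d" and d: "d \<in> A" and pos: "\<And>d. b d \<ge> 1"
  shows "width s b d + q * h \<le> width (Suc s) (advance A b) d + card (P (Suc s) \<inter> side (advance A b) d)
      + (if - {d, opp d} \<subseteq> A then 0 else 2 * h)"
proof -
  let ?b = "advance A b"
  let ?mid = "B s \<inter> seg d (b d) (lo b d) (hi b d) \<inter> seg d (b d) (lo ?b d + 1) (hi ?b d - 1)"
  have b: "?b d = b d + 1" using d by (simp add: advance_def)
  have lohi: "lo ?b d \<le> lo b d" "hi b d \<le> hi ?b d" "lo ?b d < hi ?b d"
    using lo_le_hi[of b d, OF pos] by (cases d; auto simp: advance_def)+
  have "card ?mid + q * h \<le> width (Suc s) ?b d + card (P (Suc s) \<inter> side ?b d)"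
    using advance_line[OF full[unfolded full_side_def] lohi] b by (simp add: width_def side_def)
  moreover have "width s b d \<le> card ?mid + (if - {d, opp d} \<subseteq> A then 0 else 2 * h)"
  proof (cases "- {d, opp d} \<subseteq> A")
    case True
    then have "lo ?b d + 1 = lo b d" "hi ?b d - 1 = hi b d"
      by (cases d; auto simp: advance_def)+
    then show ?thesis using True by (simp add: width_def side_def Int_assoc)
  next
    case False
    have "width s b d \<le> card (?mid \<union> (B s \<inter> seg d (b d) (lo b d) (lo b d) \<union> B s \<inter> seg d (b d) (hi b d) (hi b d)))"
      unfolding width_def side_def using lohi by (intro card_mono) (auto simp: finite_B seg_def)
    also have "\<dots> \<le> card ?mid + card (B s \<inter> seg d (b d) (lo b d) (lo b d) \<union> B s \<inter> seg d (b d) (hi b d) (hi b d))"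
      by (rule card_Un_le)
    also have "\<dots> \<le> card ?mid + (card (B s \<inter> seg d (b d) (lo b d) (lo b d)) + card (B s \<inter> seg d (b d) (hi b d) (hi b d)))"
      by (intro add_left_mono card_Un_le)
    also have "\<dots> \<le> card ?mid + (h + h)"
      by (intro add_left_mono add_mono card_seg_point_le) (auto simp: finite_B dest: layer_B)
    finally show ?thesis using False by simp
  qed
  ultimately show ?thesis by linarith
qed

lemma axis_energy_advance:
  assumes full: "\<And>d. d \<in> A \<Longrightarrow> full_side s b d" and A: "- {d, opp d} \<subseteq> A" and pos: "\<And>d. b d \<ge> 1"
  shows "axis_energy s b d + card (A \<inter> {d, opp d}) * (q * h) \<le> axis_energy (Suc s) (advance A b) d"
proof -
  let ?b = "advance A b" and ?E = "{d, opp d}"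
  have pos': "1 \<le> b East" "1 \<le> b West" "1 \<le> b North" "1 \<le> b South" using pos by auto
  have PP: "P (s + h + 1) \<subseteq> P (Suc s + h + 1)" "P (Suc s) \<subseteq> P (Suc s + h + 1)" by (auto intro!: P_mono)
  have "card (P (s + h + 1) \<inter> strip b d) + (\<Sum>e\<in>A \<inter> ?E. card (P (Suc s) \<inter> side ?b e)) \<le> card (P (Suc s + h + 1) \<inter> strip ?b d)"
  proof (rule card_pieces_le)
    have "strip b d \<subseteq> strip ?b d" by (cases d; auto simp: advance_def)
    then show "P (s + h + 1) \<inter> strip b d \<subseteq> P (Suc s + h + 1) \<inter> strip ?b d" using PP by blast
    fix e assume e: "e \<in> A \<inter> ?E"
    then have "side ?b e \<subseteq> strip ?b d" "strip b d \<inter> side ?b e = {}"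
      using pos' by (cases d; cases e; auto simp: advance_def side_def)+
    then show "P (Suc s) \<inter> side ?b e \<subseteq> P (Suc s + h + 1) \<inter> strip ?b d"
      "(P (s + h + 1) \<inter> strip b d) \<inter> (P (Suc s) \<inter> side ?b e) = {}" using PP by blast+
    fix e' assume e': "e' \<in> A \<inter> ?E" "e \<noteq> e'"
    then have "side ?b e \<inter> side ?b e' = {}"
      using e pos' by (cases d; cases e; cases e'; auto simp: advance_def side_def)
    then show "(P (Suc s) \<inter> side ?b e) \<inter> (P (Suc s) \<inter> side ?b e') = {}" by blast
  qed (simp_all add: finite_P)
  moreover have "width s b e + (if e \<in> A then q * h else 0)
      \<le> width (Suc s) ?b e + (if e \<in> A then card (P (Suc s) \<inter> side ?b e) else 0)" if "e \<in> ?E" for e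
  proof (cases "e \<in> A")
    case True
    have "- {e, opp e} \<subseteq> A" using A that by auto
    then show ?thesis using side_advance[OF full[OF True] True pos] True by simp
  next
    case False
    then have "side b e \<subseteq> side ?b e" by (intro side_mono) (auto simp: advance_def)
    then have "width s b e \<le> width (Suc s) ?b e"
      unfolding width_def using B_Suc[of s] by (intro card_mono) (auto simp: finite_B)
    with False show ?thesis by simp
  qed
  from this[of d] this[of "opp d"]
  have "width s b d + width s b (opp d) + card (A \<inter> ?E) * (q * h) \<le>
      width (Suc s) ?b d + width (Suc s) ?b (opp d) + (\<Sum>e\<in>A \<inter> ?E. card (P (Suc s) \<inter> side ?b e))"
    by (cases "d \<in> A"; cases "opp d \<in> A") (auto simp: Int_insert_right)
  ultimately show ?thesis unfolding axis_energy_def by linarith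
qed

text \<open>With a side off the axis blocked, the two sides of the axis lose up to
  \<open>4 * h\<close> cells at their ends, which must not accumulate over the turns. So the
  previous axis energy is discarded and a bound is rebuilt from the box, the widths and the wall
  beyond \<open>e\<close>, which lies in the strip.\<close>

lemma axis_energy_restart:
  assumes full: "\<And>d. d \<in> A \<Longrightarrow> full_side s b d" and e: "e \<notin> {d, opp d}" and A: "{d, opp d} \<subseteq> A"
    and pos: "\<And>d. b d \<ge> 1"
  shows "card (P s \<inter> box b) + card (P (s + h + 1) \<inter> zone h b e) + width s b d + width s b (opp d) + 2 * (q * h)
    \<le> axis_energy (Suc s) (advance A b) d + 4 * h"
proof -
  let ?b = "advance A b" and ?E = "{d, opp d}"
  have pos': "1 \<le> b East" "1 \<le> b West" "1 \<le> b North" "1 \<le> b South" using pos by auto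
  have PP: "P (s + h + 1) \<subseteq> P (Suc s + h + 1)" "P (Suc s) \<subseteq> P (Suc s + h + 1)" "P s \<subseteq> P (Suc s + h + 1)"
    by (auto intro!: P_mono)
  define F where "F = (\<lambda>e'. if e' = e then P (s + h + 1) \<inter> zone h b e else P (Suc s) \<inter> side ?b e')"
  have "card (P s \<inter> box b) + (\<Sum>e'\<in>{e, d, opp d}. card (F e')) \<le> card (P (Suc s + h + 1) \<inter> strip ?b d)"
  proof (rule card_pieces_le)
    have "box b \<subseteq> strip ?b d" by (cases d; auto simp: advance_def)
    then show "P s \<inter> box b \<subseteq> P (Suc s + h + 1) \<inter> strip ?b d" using PP by blast
    have z: "zone h b e \<subseteq> strip ?b d" "box b \<inter> zone h b e = {}"
      using pos' e by (cases d; cases e; auto simp: advance_def zone_iff)+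
    have sd: "side ?b e' \<subseteq> strip ?b d" "box b \<inter> side ?b e' = {}" "side ?b e' \<inter> zone h b e = {}" if "e' \<in> ?E" for e'
      using that pos' e A by (cases d; cases e; cases e'; auto simp: advance_def side_def zone_iff)+
    have sd2: "side ?b d \<inter> side ?b (opp d) = {}"
      using pos' A by (cases d; auto simp: advance_def side_def)
    show "F e' \<subseteq> P (Suc s + h + 1) \<inter> strip ?b d" if "e' \<in> {e, d, opp d}" for e'
      using that z(1) sd(1)[of e'] PP unfolding F_def by auto
    show "(P s \<inter> box b) \<inter> F e' = {}" if "e' \<in> {e, d, opp d}" for e'
      using that z(2) sd(2)[of e'] unfolding F_def by auto
    show "F e' \<inter> F e'' = {}" if "e' \<in> {e, d, opp d}" "e'' \<in> {e, d, opp d}" "e' \<noteq> e''" for e' e''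
      using that e sd(3)[of d] sd(3)[of "opp d"] sd2 unfolding F_def by auto
  qed (simp_all add: finite_P)
  moreover have "(\<Sum>e'\<in>{e, d, opp d}. card (F e')) = card (P (s + h + 1) \<inter> zone h b e)
      + card (P (Suc s) \<inter> side ?b d) + card (P (Suc s) \<inter> side ?b (opp d))"
    using e by (auto simp: F_def)
  moreover have "width s b e' + q * h \<le> width (Suc s) ?b e' + card (P (Suc s) \<inter> side ?b e') + 2 * h" if "e' \<in> ?E" for e'
  proof -
    have "e' \<in> A" using A that by blast
    from side_advance[OF full[OF this] this pos] show ?thesis by (auto split: if_splits)
  qed
  from this[of d] this[of "opp d"]
  have "width s b d + width s b (opp d) + 2 * (q * h) \<le> width (Suc s) ?b d + card (P (Suc s) \<inter> side ?b d)
    + width (Suc s) ?b (opp d) + card (P (Suc s) \<inter> side ?b (opp d)) + 4 * h" by simp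
  ultimately show ?thesis unfolding axis_energy_def by linarith
qed

end

subsection \<open>Fire at the critical rate\<close>

lemma card_even_le: "l \<le> u \<Longrightarrow> 2 * int (card {x. l \<le> x \<and> x \<le> u \<and> even (x + c)}) \<le> u - l + 4"
  for l u c :: int
proof -
  assume "l \<le> u"
  have "card {x. l \<le> x \<and> x \<le> u \<and> even (x + c)} \<le> card {(l + c) div 2..(u + c) div 2}"
  proof (rule card_inj_on_le[of "\<lambda>x. (x + c) div 2"])
    show "inj_on (\<lambda>x. (x + c) div 2) {x. l \<le> x \<and> x \<le> u \<and> even (x + c)}"
      by (rule inj_onI) (metis (mono_tags, lifting) add_right_cancel dvd_mult_div_cancel mem_Collect_eq)
    show "(\<lambda>x. (x + c) div 2) ` {x. l \<le> x \<and> x \<le> u \<and> even (x + c)} \<subseteq> {(l + c) div 2..(u + c) div 2}"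
    proof clarify
      fix x assume "l \<le> x" "x \<le> u"
      then show "(x + c) div 2 \<in> {(l + c) div 2..(u + c) div 2}"
        using zdiv_mono1[of "l + c" "x + c" 2] zdiv_mono1[of "x + c" "u + c" 2] by auto
    qed
  qed simp
  then show ?thesis using \<open>l \<le> u\<close> by simp
qed

definition sites :: "nat \<Rightarrow> nat \<Rightarrow> ((int \<times> int) \<times> nat) set" where
  "sites q h = {((x, y), k) | x y k. k \<in> {1..h} \<and> (q = 1 \<longrightarrow> even (x + y))}"

lemma finite_sites_seg: "finite (sites q h \<inter> seg d r l u)"
proof (rule finite_subset)
  show "sites q h \<inter> seg d r l u \<subseteq> (\<lambda>(x, k). (cell d r x, k)) ` ({l..u} \<times> {1..h})"
    by (force simp: sites_def seg_def)
qed simp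

text \<open>Doubling gives both grids one bound: sites on a line have density 1/2 in each layer for
  \<open>q = 1\<close> and density 1 for \<open>q = 2\<close>. The term \<open>4 * h\<close> absorbs
  end points and rounding. Summed over the four sides, a ring of half-perimeter \<open>p\<close>
  carries about \<open>q * h * p\<close> sites.\<close>

lemma card_sites_seg:
  assumes q: "q = 1 \<or> q = 2" and lu: "l \<le> u"
  shows "2 * int (card (sites q h \<inter> seg d r l u)) \<le> int q * int h * (u - l) + 4 * int h"
proof -
  let ?C = "sites q h \<inter> seg d r l u"
  let ?X = "\<lambda>k. {x. l \<le> x \<and> x \<le> u \<and> (cell d r x, k) \<in> ?C}"
  have "2 * int (card (?X k)) \<le> int q * (u - l) + 4" for k
  proof (cases "q = 1")
    case True
    have "?X k \<subseteq> {x. l \<le> x \<and> x \<le> u \<and> even (x + r)}"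
      using True by (cases d) (auto simp: sites_def)
    then have "card (?X k) \<le> card {x. l \<le> x \<and> x \<le> u \<and> even (x + r)}"
      by (rule card_mono[rotated]) (rule finite_subset[of _ "{l..u}"], auto)
    with card_even_le[OF lu, of r] True show ?thesis by simp
  next
    case False
    have "card (?X k) \<le> card {l..u}" by (intro card_mono) auto
    with lu q False show ?thesis by simp
  qed
  then have "(\<Sum>k\<in>{1..h}. 2 * int (card (?X k))) \<le> (\<Sum>k\<in>{1..h}. int q * (u - l) + 4)"
    by (intro sum_mono)
  moreover have "card (?C \<inter> seg d r l u) = (\<Sum>k\<in>{1..h}. card (?X k))"
    by (rule card_seg[OF finite_sites_seg]) (auto simp: sites_def)
  ultimately show ?thesis
    by (simp add: sum_distrib_left[symmetric] algebra_simps)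
qed

context slab_fire
begin

lemma width_le:
  assumes "lo b d \<le> hi b d"
  shows "2 * int (width s b d) \<le> int q * int h * (hi b d - lo b d) + 4 * int h"
proof -
  have "B s \<subseteq> sites q h"
  proof clarify
    fix x y k assume "((x, y), k) \<in> B s"
    then show "((x, y), k) \<in> sites q h"
      using layer_B[of "(x, y)" k s] parity[of x y k s] by (simp add: sites_def)
  qed
  then have "width s b d \<le> card (sites q h \<inter> seg d (b d) (lo b d) (hi b d))"
    unfolding width_def side_def by (intro card_mono finite_sites_seg) auto
  then show ?thesis using card_sites_seg[OF q assms, of h d "b d"] by linarith
qed

lemma card_ring_le: "card (B s \<inter> ring b) \<le> width s b East + width s b West + width s b North + width s b South"
proof -
  have "B s \<inter> ring b = (\<Union>d\<in>UNIV. B s \<inter> side b d)" by (auto simp: ring_def)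
  then show ?thesis
    using card_UN_le[of "UNIV :: dir set" "\<lambda>d. B s \<inter> side b d"] by (simp add: sum_dir width_def)
qed

lemma protected_ge:
  assumes "\<And>d. b d \<ge> 1"
  shows "card (P s \<inter> box b) + card (P (s + h + 1) \<inter> zone h b East) + card (P (s + h + 1) \<inter> zone h b West)
    + card (P (s + h + 1) \<inter> zone h b North) + card (P (s + h + 1) \<inter> zone h b South) \<le> card (P (s + h + 1))"
proof -
  have "P s \<subseteq> P (s + h + 1)" by (intro P_mono) simp
  then have "card (P s \<inter> box b) \<le> card (P (s + h + 1) \<inter> box b)"
    by (intro card_mono) (auto simp: finite_P)
  then show ?thesis
    using card_box_zones[where C = "P (s + h + 1)" and m = h and b = b, OF finite_P assms] by (simp add: sum_dir)
qed

end

text \<open>\<open>F\<close> bounds the fire for all times. The condition \<open>large\<close> says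
  that the head start of the initial square exceeds the total error that can build up: the budget of
  \<open>h + 1\<close> further turns, the roundings of the widths, and up to five times the error in
  recognising a wall.\<close>

locale contained_slab_fire = slab_fire +
  fixes n :: int and F :: "((int \<times> int) \<times> nat) set"
  assumes budget: "2 * card (P t) \<le> 3 * (q * h) * t"
    and n: "n \<ge> 1"
    and initial: "4 * (int q * int h) * n \<le> int (energy 0 (\<lambda>d. n))"
    and finite_F: "finite F" and B_F: "B t \<subseteq> F"
    and large: "3 * (int q * int h) * (int h + 1) + 14 * int h
      + 5 * (int h * int h * (int h * int h + (int q * int h * int h + 4 * (int q * int h) * (int h + 1) + 1)) + int h * int h)
      < 4 * (int q * int h) * n"
begin

section \<open>Constants and the invariant of a contained fire\<close>

definition Q :: int where "Q = int q * int h"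
definition L :: int where "L = int h + 1"
text \<open>A jump may cost a lag of \<open>4 * L\<close> in the half-perimeter, worth
  \<open>4 * Q * L\<close> of energy. The extra 1 lets the number of jumps be bounded directly by
  the energy.\<close>

definition gain :: int where "gain = 4 * Q * L + 1"
text \<open>A jump lengthens the half-perimeter by at most \<open>h\<close>, for which the invariant
  demands \<open>Q * h\<close> more energy; the rest of the surplus is \<open>gain\<close>.\<close>

definition bonus :: nat where "bonus = q * h * h + 4 * (q * h) * (h + 1) + 1"
definition wall_loss :: int where "wall_loss = int h * int h * (int h * int h + int bonus) + int h * int h"
definition reach :: int where "reach = Max ((\<lambda>((x, y), k). max \<bar>x\<bar> \<bar>y\<bar>) ` F \<union> {0})"

lemma large': "3 * Q * L + 14 * int h + 5 * wall_loss < 4 * Q * n"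
  using large by (simp add: Q_def L_def wall_loss_def bonus_def algebra_simps)

lemma Q_ge: "Q \<ge> 1"
  using q h by (auto simp: Q_def)

lemma bonus_eq: "int bonus = Q * int h + gain"
  by (simp add: bonus_def Q_def gain_def L_def algebra_simps)

lemma L_ge: "L \<ge> 2" using h by (simp add: L_def)

lemma QL_nonneg: "0 \<le> Q * L" using Q_ge L_ge by simp

lemma wall_loss_nonneg: "0 \<le> wall_loss" by (simp add: wall_loss_def)

lemma reach_ge:
  assumes "((x, y), k) \<in> B s"
  shows "\<bar>x\<bar> \<le> reach" "\<bar>y\<bar> \<le> reach"
proof -
  have "max \<bar>x\<bar> \<bar>y\<bar> \<le> reach"
    unfolding reach_def using assms B_F[of s] finite_F by (intro Max_ge) force+
  then show "\<bar>x\<bar> \<le> reach" "\<bar>y\<bar> \<le> reach" by auto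
qed

definition half_perimeter :: "(dir \<Rightarrow> int) \<Rightarrow> int" where
  "half_perimeter b = b East + b West + b North + b South"

definition axis :: "(dir \<Rightarrow> int) \<Rightarrow> dir \<Rightarrow> int" where
  "axis b d = b d + b (opp d)"

text \<open>
  At turn \<open>s\<close>, after \<open>m\<close> advances and \<open>j\<close> jumps of length \<open>L\<close>, the box \<open>b\<close> lags behind the box of radius
  \<open>n + s\<close> by at most one side per advance and \<open>4 L\<close> per jump. The disjunction says that as soon as the sides of one axis
  have been blocked, the wall that blocked them is accounted for in the energy of the other axis.
\<close>

definition state :: "nat \<Rightarrow> (dir \<Rightarrow> int) \<Rightarrow> nat \<Rightarrow> nat \<Rightarrow> bool" where
  "state s b m j \<longleftrightarrow>
     int s = int m + L * int j \<and>
     (\<forall>d. n \<le> b d \<and> b d \<le> n + int s) \<and>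
     Q * half_perimeter b + gain * int j \<le> int (energy s b) \<and>
     4 * n + 4 * int s - half_perimeter b \<le> int m + 4 * L * int j \<and>
     (\<forall>d. 2 * n + 2 * int s - (half_perimeter b - axis b d) \<le> 4 * L * int j \<or>
        Q * axis b d - (wall_loss + 6 * int h) \<le> int (axis_energy s b d)) \<and>
     int m \<le> (\<Sum>d\<in>UNIV. min (b d) (reach + 1))"

lemma wall:
  assumes "\<not> full_side s b d" and "\<And>i. i \<in> {1..h} \<Longrightarrow> \<not> surplus bonus s b d i"
  shows "int (width s b d) \<le> int (card (P (s + h + 1) \<inter> zone h b d)) + wall_loss"
proof -
  have "int (width s b d) \<le> int (card (P (s + h + 1) \<inter> zone h b d) + (h * h * (h * h + bonus) + h * h))"
    using wall_if_no_surplus[OF assms] by (rule of_nat_mono)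
  then show ?thesis by (simp add: wall_loss_def)
qed

lemma hi_lo: "hi b d - lo b d = half_perimeter b - axis b d"
  by (cases d) (auto simp: half_perimeter_def axis_def)

lemma width_le':
  assumes "\<And>d. b d \<ge> 1"
  shows "2 * int (width s b d) \<le> Q * (half_perimeter b - axis b d) + 4 * int h"
  using width_le[of b d s] lo_le_hi[of b d, OF assms] by (simp add: hi_lo Q_def)

lemma energy_le: "int (energy s b) \<le> int (card (P s \<inter> box b)) + int (width s b East) + int (width s b West)
    + int (width s b North) + int (width s b South)"
  using card_ring_le[of s b] by (simp add: energy_def)

text \<open>The widths of blocked sides are replaced by the protected cells of their walls, so the
  budget bounds them; the free sides are bounded by their lengths. For adjacent walls the free sides
  account for half of \<open>Q * half_perimeter b\<close>, leaving
  \<open>Q * half_perimeter b\<close> at most \<open>3 * Q * s\<close> up to constants, while the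
  invariant puts \<open>half_perimeter b\<close> above \<open>4 * n + 3 * s - 3 * L * j\<close>. The
  energy gained in the jumps covers the last term.\<close>

lemma at_most_one_wall:
  assumes st: "state s b m j" and ns: "\<And>d i. i \<in> {1..h} \<Longrightarrow> \<not> surplus bonus s b d i"
    and "\<not> full_side s b d" "\<not> full_side s b e"
  shows "d = e"
proof (rule ccontr)
  assume "d \<noteq> e"
  let ?p = "int (card (P s \<inter> box b))" and ?C = "int (card (P (s + h + 1)))"
  let ?w = "\<lambda>d. int (width s b d)" and ?z = "\<lambda>d. int (card (P (s + h + 1) \<inter> zone h b d))"
  have pos: "\<And>d. b d \<ge> 1" using st n unfolding state_def by (meson order_trans)
  have s: "int s = int m + L * int j" and en: "Q * half_perimeter b + gain * int j \<le> int (energy s b)"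
    and delay: "4 * n + 4 * int s - half_perimeter b \<le> int m + 4 * L * int j"
    using st by (auto simp: state_def)
  have bud: "2 * ?C \<le> 3 * Q * (int s + L)"
    using of_nat_mono[OF budget[of "s + h + 1"], where 'a = int] by (simp add: Q_def L_def algebra_simps)
  have wd: "?w d \<le> ?z d + wall_loss" "?w e \<le> ?z e + wall_loss"
    using wall ns assms(3,4) by blast+
  have pro: "?p + ?z East + ?z West + ?z North + ?z South \<le> ?C"
    using protected_ge[OF pos, where s = s] unfolding of_nat_add[symmetric] of_nat_le_iff .
  have "Q * (4 * n + 4 * int s - half_perimeter b) \<le> Q * (int m + 4 * L * int j)"
    using delay Q_ge by (intro mult_left_mono) auto
  also have "\<dots> = Q * int s + 3 * (Q * L * int j)"
    by (simp add: s algebra_simps)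
  finally have tot: "Q * half_perimeter b \<ge> 4 * Q * n + 3 * Q * int s - 3 * (Q * L * int j)"
    by (simp add: algebra_simps)
  have g: "gain * int j = 4 * (Q * L * int j) + int j" by (simp add: gain_def algebra_simps)
  have QLj: "0 \<le> Q * L * int j" using QL_nonneg by simp
  have wl: "2 * ?w d' \<le> Q * (half_perimeter b - axis b d') + 4 * int h" for d' using width_le'[OF pos] .
  have lg: "3 * Q * L + 14 * int h + 5 * wall_loss < 4 * Q * n" by (rule large')
  show False
  proof (cases "e = opp d")
    case True
    \<comment> \<open>For opposite walls the free sides have length \<open>axis b d\<close>,
      possibly more than half of the half-perimeter. If the perpendicular axis has kept pace except
      for jumps, it contributes \<open>2 * Q * s\<close> against a budget of
      \<open>3 / 2 * Q * s\<close>, and the ring energy suffices. Otherwise the axis energy gives a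
      second estimate, and adding the two cancels \<open>Q * axis b d\<close>.\<close>
    obtain f where f: "f \<notin> {d, opp d}" by (cases d) auto
    have "?p + ?w d + ?w e + ?w f + ?w (opp f) \<ge> int (energy s b)"
      using energy_le[of s b] True f by (cases d; cases f; simp)
    moreover have "?p + ?z d + ?z e \<le> ?C"
      using pro True by (cases d; simp)
    moreover have "axis b f = half_perimeter b - axis b d" "axis b (opp f) = half_perimeter b - axis b d"
      using f by (cases d; cases f; simp add: axis_def half_perimeter_def)+
    ultimately have 1: "int (energy s b) \<le> ?C + 2 * wall_loss + Q * axis b d + 4 * int h"
      using wl[of f] wl[of "opp f"] wd by simp
    have 2: "int (axis_energy s b d) \<le> ?C + 2 * wall_loss"
      using card_strip_zones[where C = "P (s + h + 1)" and m = h and d = d and b = b, OF finite_P pos] wd True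
      unfolding axis_energy_def by simp
    have "2 * n + 2 * int s - (half_perimeter b - axis b d) \<le> 4 * L * int j \<or>
        Q * axis b d - (wall_loss + 6 * int h) \<le> int (axis_energy s b d)" 
      using st unfolding state_def by blast
    then show False
    proof
      assume "2 * n + 2 * int s - (half_perimeter b - axis b d) \<le> 4 * L * int j"
      then have "Q * (2 * n + 2 * int s - (half_perimeter b - axis b d)) \<le> Q * (4 * L * int j)"
        using Q_ge by (intro mult_left_mono) auto
      then have "Q * half_perimeter b - Q * axis b d \<ge> 2 * Q * n + 2 * Q * int s - 4 * (Q * L * int j)"
        by (simp add: algebra_simps)
      with 1 en g have "2 * Q * n + 2 * Q * int s \<le> ?C + 2 * wall_loss + 4 * int h" by linarith
      moreover have "0 \<le> Q * int s" using Q_ge by simp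
      moreover have "3 * Q * (int s + L) = 3 * (Q * int s) + 3 * Q * L" by (simp add: algebra_simps)
      ultimately show False using bud lg wall_loss_nonneg by linarith
    next
      assume "Q * axis b d - (wall_loss + 6 * int h) \<le> int (axis_energy s b d)"
      with 1 2 en g have "Q * half_perimeter b + 4 * (Q * L * int j) \<le> 2 * ?C + 5 * wall_loss + 10 * int h" by linarith
      moreover have "3 * Q * (int s + L) = 3 * (Q * int s) + 3 * Q * L" by (simp add: algebra_simps)
      ultimately show False using bud lg tot QLj by linarith
    qed
  next
    case False
    have "?p + ?w d + ?w e + ?w (opp d) + ?w (opp e) \<ge> int (energy s b)"
      using energy_le[of s b] False \<open>d \<noteq> e\<close> by (cases d; cases e; simp)
    moreover have "?p + ?z d + ?z e \<le> ?C"
      using pro False \<open>d \<noteq> e\<close> by (cases d; cases e; simp)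
    moreover have "axis b (opp d) + axis b (opp e) = half_perimeter b"
      using False \<open>d \<noteq> e\<close> by (cases d; cases e; simp add: axis_def half_perimeter_def)
    then have "Q * (half_perimeter b - axis b (opp d)) + Q * (half_perimeter b - axis b (opp e)) = Q * half_perimeter b"
      by (simp add: algebra_simps flip: distrib_left)
    ultimately have "2 * int (energy s b) \<le> 2 * ?C + 4 * wall_loss + Q * half_perimeter b + 8 * int h"
      using wl[of "opp d"] wl[of "opp e"] wd by linarith
    then have "Q * half_perimeter b + 8 * (Q * L * int j) \<le> 2 * ?C + 4 * wall_loss + 8 * int h"
      using en g by linarith
    moreover have "3 * Q * (int s + L) = 3 * (Q * int s) + 3 * Q * L" by (simp add: algebra_simps)
    ultimately show False using bud lg tot QLj wall_loss_nonneg by linarith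
  qed
qed

lemma state_jump:
  assumes st: "state s b m j" and i: "i \<in> {1..h}" and sp: "surplus bonus s b e i"
  shows "state (s + h + 1) (b(e := b e + int i)) m (Suc j)"
proof -
  let ?b = "b(e := b e + int i)" and ?s = "s + h + 1"
  have pos: "\<And>d. b d \<ge> 1" using st n unfolding state_def by (meson order_trans)
  have i': "1 \<le> int i" "int i \<le> int h" "i \<ge> 1" using i by auto
  have Qi: "Q * int i \<le> Q * int h" using Q_ge i' by (intro mult_left_mono) auto
  have gain: "0 \<le> gain" using QL_nonneg by (simp add: gain_def)
  have tot: "half_perimeter ?b = half_perimeter b + int i" by (cases e) (auto simp: half_perimeter_def)
  have ax: "axis ?b d = axis b d + (if e \<in> {d, opp d} then int i else 0)" for d
    by (cases e; cases d; simp add: axis_def)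
  have s: "int ?s = int s + L" by (simp add: L_def)
  have "int (energy s b) + int bonus \<le> int (energy ?s ?b)"
    using energy_jump[OF sp i'(3) pos] unfolding of_nat_add[symmetric] of_nat_le_iff .
  then have "Q * half_perimeter ?b + gain * int (Suc j) \<le> int (energy ?s ?b)"
    using st Qi unfolding state_def tot bonus_eq by (simp add: algebra_simps)
  moreover have "2 * n + 2 * int ?s - (half_perimeter ?b - axis ?b d) \<le> 4 * L * int (Suc j) \<or>
      Q * axis ?b d - (wall_loss + 6 * int h) \<le> int (axis_energy ?s ?b d)" for d
  proof -
    have "int (axis_energy s b d) + (if e \<in> {d, opp d} then int bonus else 0) \<le> int (axis_energy ?s ?b d)"
      using of_nat_mono[OF axis_energy_jump[OF sp i'(3) pos, of d], where 'a = int] by (cases "e \<in> {d, opp d}") auto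
    then have "int (axis_energy s b d) + Q * (axis ?b d - axis b d) \<le> int (axis_energy ?s ?b d)"
      using Qi gain unfolding ax bonus_eq by (cases "e \<in> {d, opp d}") auto
    moreover have "2 * n + 2 * int s - (half_perimeter b - axis b d) \<le> 4 * L * int j \<or>
        Q * axis b d - (wall_loss + 6 * int h) \<le> int (axis_energy s b d)"
      using st unfolding state_def by blast
    moreover have "half_perimeter b - axis b d \<le> half_perimeter ?b - axis ?b d" using i' by (simp add: tot ax)
    moreover have "4 * L * int (Suc j) = 4 * L * int j + 4 * L" by (simp add: algebra_simps)
    ultimately show ?thesis using L_ge s by (auto simp: algebra_simps)
  qed
  moreover have "int m \<le> (\<Sum>d\<in>UNIV. min (?b d) (reach + 1))"
  proof -
    have "(\<Sum>d\<in>UNIV. min (b d) (reach + 1)) \<le> (\<Sum>d\<in>UNIV. min (?b d) (reach + 1))"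
      by (intro sum_mono) auto
    then show ?thesis using st unfolding state_def by linarith
  qed
  moreover have "n \<le> ?b d \<and> ?b d \<le> n + int ?s" for d
  proof -
    have "n \<le> b d \<and> b d \<le> n + int s" using st unfolding state_def by blast
    then show ?thesis using i' by auto
  qed
  moreover have "4 * n + 4 * int ?s - half_perimeter ?b \<le> int m + 4 * L * int (Suc j)"
    using st i' unfolding state_def tot s by (simp add: algebra_simps)
  moreover have "int ?s = int m + L * int (Suc j)"
    using st unfolding state_def s by (simp add: algebra_simps)
  ultimately show ?thesis unfolding state_def by blast
qed

text \<open>At most one side is blocked, so the half-perimeter grows by at least 3 and its lag by at
  most 1. The clause on an axis survives unchanged while both perpendicular sides advance; when one
  of them is blocked, the second alternative is established afresh.\<close>

lemma state_advance:
  assumes st: "state s b m j" and ns: "\<And>d i. i \<in> {1..h} \<Longrightarrow> \<not> surplus bonus s b d i"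
  shows "state (Suc s) (advance {d. full_side s b d} b) (Suc m) j"
proof -
  let ?A = "{d. full_side s b d}"
  let ?b = "advance ?A b" and ?s = "Suc s"
  have pos: "\<And>d. b d \<ge> 1" using st n unfolding state_def by (meson order_trans)
  have A: "\<And>d. d \<in> ?A \<Longrightarrow> full_side s b d" by simp
  have one: "d = e" if "d \<notin> ?A" "e \<notin> ?A" for d e
    using at_most_one_wall[OF st ns] that by blast
  have tot: "half_perimeter ?b = half_perimeter b + int (card ?A)"
  proof -
    have "int (card ?A) = (\<Sum>d\<in>UNIV. if d \<in> ?A then 1 else 0)" by (simp add: sum.If_cases)
    then show ?thesis by (simp add: sum_dir half_perimeter_def advance_def)
  qed
  have ax: "axis ?b d = axis b d + int (card (?A \<inter> {d, opp d}))" for d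
    by (cases "d \<in> ?A"; cases "opp d \<in> ?A") (simp_all add: axis_def advance_def Int_insert_right)
  have cA: "int (card ?A) \<ge> 3"
  proof -
    have "card (- ?A) \<le> 1"
    proof (cases "- ?A = {}")
      case False
      then obtain e where "- ?A \<subseteq> {e}" using one by blast
      then show ?thesis using card_mono[of "{e}" "- ?A"] by simp
    qed simp
    moreover have "card (UNIV :: dir set) = 4" by (simp add: UNIV_dir)
    ultimately show ?thesis by (simp add: Compl_eq_Diff_UNIV card_Diff_subset)
  qed
  have "int (energy s b) + int (card ?A) * Q \<le> int (energy ?s ?b)"
    using of_nat_mono[OF energy_advance[OF A pos, of ?A], where 'a = int] by (simp add: Q_def)
  then have "Q * half_perimeter ?b + gain * int j \<le> int (energy ?s ?b)"
    using st unfolding state_def tot by (simp add: algebra_simps)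
  moreover have "2 * n + 2 * int ?s - (half_perimeter ?b - axis ?b d) \<le> 4 * L * int j \<or>
      Q * axis ?b d - (wall_loss + 6 * int h) \<le> int (axis_energy ?s ?b d)" for d
  proof (cases "- {d, opp d} \<subseteq> ?A")
    case True
    have "int (axis_energy s b d) + int (card (?A \<inter> {d, opp d})) * Q \<le> int (axis_energy ?s ?b d)"
      using of_nat_mono[OF axis_energy_advance[OF A True pos], where 'a = int] by (simp add: Q_def)
    then have "int (axis_energy s b d) + Q * axis ?b d \<le> int (axis_energy ?s ?b d) + Q * axis b d"
      unfolding ax by (simp add: algebra_simps)
    moreover have "2 * n + 2 * int s - (half_perimeter b - axis b d) \<le> 4 * L * int j \<or>
        Q * axis b d - (wall_loss + 6 * int h) \<le> int (axis_energy s b d)"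
      using st unfolding state_def by blast
    moreover have "half_perimeter ?b - axis ?b d = half_perimeter b - axis b d + 2"
      using True by (cases d; simp add: half_perimeter_def axis_def advance_def subset_iff)
    ultimately show ?thesis by auto
  next
    case False
    then obtain e where e: "e \<notin> {d, opp d}" "e \<notin> ?A" by blast
    then have dA: "{d, opp d} \<subseteq> ?A" using one[OF e(2)] by blast
    let ?p = "int (card (P s \<inter> box b))" and ?z = "int (card (P (s + h + 1) \<inter> zone h b e))"
    let ?w = "\<lambda>d. int (width s b d)"
    have "?p + ?z + ?w d + ?w (opp d) + 2 * Q \<le> int (axis_energy ?s ?b d) + 4 * int h"
      using of_nat_mono[OF axis_energy_restart[OF A e(1) dA pos], where 'a = int] by (simp add: Q_def)
    moreover have "?w e \<le> ?z + wall_loss" using wall ns e(2) by simp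
    moreover have "int (energy s b) \<le> ?p + ?w d + ?w (opp d) + ?w e + ?w (opp e)"
      using energy_le[of s b] e(1) by (cases d; cases e; simp)
    moreover have "2 * ?w (opp e) \<le> Q * axis b d + 4 * int h"
    proof -
      have "half_perimeter b - axis b (opp e) = axis b d" using e(1) by (cases d; cases e; simp add: half_perimeter_def axis_def)
      then show ?thesis using width_le'[of b s "opp e", OF pos] by simp
    qed
    ultimately have 1: "2 * int (energy s b) + 4 * Q \<le> 2 * int (axis_energy ?s ?b d) + Q * axis b d + 2 * wall_loss + 12 * int h"
      by linarith
    have "card (?A \<inter> {d, opp d}) = 2" using dA by (simp add: Int_absorb1)
    then have axd: "axis ?b d = axis b d + 2" by (simp add: ax)
    have en: "Q * half_perimeter b + gain * int j \<le> int (energy s b)" and s: "int s = int m + L * int j"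
      and delay: "4 * n + 4 * int s - half_perimeter b \<le> int m + 4 * L * int j"
      using st by (auto simp: state_def)
    \<comment> \<open>The restarted bound needs twice the energy to be at least
      \<open>3 * Q * axis b d\<close>. No side is farther out than \<open>n + s\<close>, so the axis
      is at most \<open>2 * n + 2 * s\<close>, whereas the half-perimeter is at least
      \<open>4 * n + 3 * s - 3 * L * j\<close>; twice \<open>gain * j\<close> exceeds the missing
      \<open>6 * Q * L * j\<close>.\<close>
    have "axis b d \<le> 2 * n + 2 * int s"
      using st unfolding state_def axis_def by (smt (verit))
    then have "- 6 * (L * int j) \<le> 2 * half_perimeter b - 3 * axis b d"
      using delay n s by linarith
    then have "Q * (- 6 * (L * int j)) \<le> Q * (2 * half_perimeter b - 3 * axis b d)"
      using Q_ge by (intro mult_left_mono) auto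
    then have "3 * (Q * axis b d) \<le> 2 * (Q * half_perimeter b) + 6 * (Q * L * int j)"
      by (simp add: algebra_simps)
    moreover have "gain * int j = 4 * (Q * L * int j) + int j" by (simp add: gain_def algebra_simps)
    moreover have "0 \<le> Q * L * int j" using QL_nonneg by simp
    moreover have "Q * axis ?b d = Q * axis b d + 2 * Q" unfolding axd by (simp add: algebra_simps)
    ultimately have "Q * axis ?b d - (wall_loss + 6 * int h) \<le> int (axis_energy ?s ?b d)"
      using 1 en by linarith
    then show ?thesis by blast
  qed
  moreover have "int (Suc m) \<le> (\<Sum>d\<in>UNIV. min (?b d) (reach + 1))"
  proof -
    have "?A \<noteq> {}" using cA by force
    then obtain d where d: "d \<in> ?A" by blast
    \<comment> \<open>A full side meets the fire, hence \<open>F\<close>. So an advancing side has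
      not yet reached the cap \<open>reach + 1\<close>, and the capped sum grows with every
      advance.\<close>
    have "b d \<le> reach"
    proof -
      obtain x where "(cell d (b d) x, 1) \<in> B s"
        using d h unfolding full_side_def full_def by (auto dest: bspec[of _ _ 1])
      then show ?thesis by (cases d) (auto dest: reach_ge)
    qed
    then have "min (b d) (reach + 1) < min (?b d) (reach + 1)" using d by (simp add: advance_def)
    then have "(\<Sum>d\<in>UNIV. min (b d) (reach + 1)) < (\<Sum>d\<in>UNIV. min (?b d) (reach + 1))"
      by (intro sum_strict_mono_ex1) (auto simp: advance_def)
    then show ?thesis using st unfolding state_def by linarith
  qed
  moreover have "n \<le> ?b d \<and> ?b d \<le> n + int ?s" for d
  proof -
    have "n \<le> b d \<and> b d \<le> n + int s" using st unfolding state_def by blast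
    then show ?thesis by (auto simp: advance_def)
  qed
  moreover have "4 * n + 4 * int ?s - half_perimeter ?b \<le> int (Suc m) + 4 * L * int j"
    using st cA unfolding state_def tot by simp
  moreover have "int ?s = int (Suc m) + L * int j"
    using st unfolding state_def by simp
  ultimately show ?thesis unfolding state_def by blast
qed

lemma state_0: "state 0 (\<lambda>d. n) 0 0"
proof -
  have "0 \<le> reach" unfolding reach_def using finite_F by (intro Max_ge) auto
  then show ?thesis
    using initial n by (auto simp: state_def half_perimeter_def axis_def Q_def sum_dir algebra_simps)
qed

lemma exists_state: "\<exists>s b m j. state s b m j \<and> m + j = N"
proof (induction N)
  case 0
  then show ?case using state_0 by blast
next
  case (Suc N)
  then obtain s b m j where st: "state s b m j" and N: "m + j = N" by blast
  show ?case
  proof (cases "\<exists>d. \<exists>i\<in>{1..h}. surplus bonus s b d i")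
    case True
    then obtain d i where "i \<in> {1..h}" "surplus bonus s b d i" by blast
    from state_jump[OF st this] show ?thesis using N by force
  next
    case False
    then have "state (Suc s) (advance {d. full_side s b d} b) (Suc m) j"
      by (intro state_advance[OF st]) blast
    then show ?thesis using N by force
  qed
qed

text \<open>The state can be continued forever, yet both kinds of step are bounded: advances by the
  capped sum, and jumps because each adds \<open>gain\<close> to the energy, while the energy is at
  most \<open>card F\<close> plus the budget, which grows by only \<open>3 / 2 * Q * L\<close> per
  jump.\<close>

lemma contradiction: False
proof -
  define K where "K = 4 * (reach + 1)"
  define N where "N = nat (K + 3 * Q * K + 2 * int (card F)) + 1"
  obtain s b m j where st: "state s b m j" and N: "m + j = N" using exists_state by blast
  have m: "int m \<le> K"
  proof -
    have "(\<Sum>d\<in>UNIV. min (b d) (reach + 1)) \<le> (\<Sum>d\<in>(UNIV :: dir set). reach + 1)" by (intro sum_mono) simp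
    also have "\<dots> = K" by (simp add: K_def UNIV_dir)
    finally show ?thesis using st unfolding state_def by linarith
  qed
  have pos: "\<And>d. b d \<ge> 1" using st n unfolding state_def by (meson order_trans)
  have "0 \<le> half_perimeter b" using pos[of East] pos[of West] pos[of North] pos[of South] by (simp add: half_perimeter_def)
  then have "0 \<le> Q * half_perimeter b" using Q_ge by simp
  then have "gain * int j \<le> int (energy s b)" using st unfolding state_def by linarith
  moreover have "int (energy s b) \<le> int (card F) + int (card (P s))"
  proof -
    have "card (B s \<inter> ring b) \<le> card F" using B_F finite_F by (intro card_mono) auto
    moreover have "card (P s \<inter> box b) \<le> card (P s)" by (intro card_mono) (auto simp: finite_P)
    ultimately show ?thesis by (simp add: energy_def)
  qed
  moreover have "2 * int (card (P s)) \<le> 3 * Q * int s"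
    using of_nat_mono[OF budget[of s], where 'a = int] by (simp add: Q_def algebra_simps)
  moreover have "3 * Q * int s = 3 * (Q * int m) + 3 * (Q * L * int j)"
    using st by (simp add: state_def algebra_simps)
  moreover have "gain * int j = 4 * (Q * L * int j) + int j" by (simp add: gain_def algebra_simps)
  moreover have "0 \<le> Q * L * int j" using QL_nonneg by simp
  moreover have "Q * int m \<le> Q * K" using m Q_ge by (intro mult_left_mono) auto
  ultimately have "int j \<le> 3 * Q * K + 2 * int (card F)" by linarith
  then show False using m N unfolding N_def by linarith
qed

end

subsection \<open>The slab graphs\<close>

definition slab :: "nat \<Rightarrow> nat \<Rightarrow> ((int \<times> int) \<times> nat) pair_pre_digraph" where
  "slab q h = (if q = 1 then G1 h else G2 h)"

fun coords :: "nat \<Rightarrow> (int \<times> int) \<times> nat \<Rightarrow> (int \<times> int) \<times> nat" where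
  "coords q ((x, y), k) = (if q = 1 then (x + y, x - y) else (x, y), k)"

fun radius :: "(int \<times> int) \<times> nat \<Rightarrow> int" where
  "radius ((x, y), k) = max \<bar>x\<bar> \<bar>y\<bar>"

fun adjacent :: "(int \<times> int) \<times> nat \<Rightarrow> (int \<times> int) \<times> nat \<Rightarrow> bool" where
  "adjacent ((x, y), k) ((x', y'), k') \<longleftrightarrow>
    max \<bar>x - x'\<bar> \<bar>y - y'\<bar> = 1 \<and> k = k' \<or> x = x' \<and> y = y' \<and> \<bar>int k - int k'\<bar> = 1"

lemma inj_coords: "inj (coords q)"
  by (auto simp: inj_def)

lemma snd_coords [simp]: "snd (coords q v) = snd v"
proof -
  obtain x y k where "v = ((x, y), k)" by (metis surj_pair)
  then show ?thesis by simp
qed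

lemma range_coords:
  assumes "q = 1 \<or> q = 2"
  shows "((x, y), k) \<in> range (coords q) \<longleftrightarrow> (q = 1 \<longrightarrow> even (x + y))"
proof (cases "q = 1")
  case True
  have "((x, y), k) \<in> range (coords 1)" if ev: "even (x + y)"
  proof -
    obtain a where "x + y = 2 * a" using ev by (rule evenE)
    then have "((x, y), k) = coords 1 ((a, x - a), k)" by simp
    then show ?thesis by blast
  qed
  moreover have "even (x + y)" if "((x, y), k) \<in> range (coords 1)"
    using that by (auto simp: image_iff)
  ultimately show ?thesis using True by blast
next
  case False
  then have "((x, y), k) = coords q ((x, y), k)" by simp
  then show ?thesis using False by blast
qed

lemma parcs_slab_iff:
  assumes "q = 1 \<or> q = 2"
  shows "(v, w) \<in> parcs (slab q h) \<longleftrightarrow> snd v \<in> {1..h} \<and> snd w \<in> {1..h} \<and> adjacent (coords q v) (coords q w)"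
proof -
  obtain x y k x' y' k' where vw: "v = ((x, y), k)" "w = ((x', y'), k')"
    by (metis surj_pair)
  show ?thesis
  proof (cases "q = 1")
    case True
    have "max \<bar>x + y - (x' + y')\<bar> \<bar>x - y - (x' - y')\<bar> = \<bar>x - x'\<bar> + \<bar>y - y'\<bar>" by linarith
    moreover have "x + y = x' + y' \<and> x - y = x' - y' \<longleftrightarrow> x = x' \<and> y = y'" by linarith
    ultimately show ?thesis
      using True by (simp add: slab_def vw parcs_G1_iff) blast
  next
    case False
    then show ?thesis
      using assms by (simp add: slab_def vw parcs_G2_iff)
  qed
qed

lemma pverts_slab: "v \<in> pverts (slab q h) \<longleftrightarrow> snd v \<in> {1..h}"
  by (cases v) (simp add: slab_def pverts_G1 pverts_G2)

lemma radius_adjacent: "adjacent c c' \<Longrightarrow> radius c' \<le> radius c + 1"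
  by (cases "(c, c')" rule: adjacent.cases) auto

definition ball :: "nat \<Rightarrow> int \<Rightarrow> ((int \<times> int) \<times> nat) set" where
  "ball h m = {c. radius c \<le> m \<and> snd c \<in> {1..h}}"

lemma finite_ball: "finite (ball h m)"
proof (rule finite_subset)
  show "ball h m \<subseteq> ({-m..m} \<times> {-m..m}) \<times> {1..h}" by (auto simp: ball_def)
qed simp

lemma finite_coords_vimage: "finite C \<Longrightarrow> finite (coords q -` C)"
  by (intro finite_vimageI inj_coords)

section \<open>From the game on the graph to the fire in max-norm coordinates\<close>

lemma burning_mono: "s \<le> t \<Longrightarrow> burning G B0 P s \<subseteq> burning G B0 P t"
  by (rule lift_Suc_mono_le[of "burning G B0 P"]) auto

lemma burning_in_ball:
  assumes q: "q = 1 \<or> q = 2" and B0: "coords q ` B0 \<subseteq> ball h m"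
  shows "coords q ` burning (slab q h) B0 P t \<subseteq> ball h (m + int t)"
proof (induction t)
  case 0
  then show ?case using B0 by simp
next
  case (Suc t)
  show ?case
  proof
    fix c assume "c \<in> coords q ` burning (slab q h) B0 P (Suc t)"
    then obtain v where v: "c = coords q v" "v \<in> burning (slab q h) B0 P (Suc t)" by blast
    show "c \<in> ball h (m + int (Suc t))"
    proof (cases "v \<in> burning (slab q h) B0 P t")
      case True
      with Suc.IH v(1) show ?thesis by (auto simp: ball_def)
    next
      case False
      with v obtain u where "u \<in> burning (slab q h) B0 P t" "(u, v) \<in> parcs (slab q h)" by auto
      with Suc.IH v(1) radius_adjacent[of "coords q u" "coords q v"] show ?thesis
        by (fastforce simp: ball_def parcs_slab_iff[OF q])
    qed
  qed
qed

lemma protected_upto_Suc: "protected_upto P (Suc t) = protected_upto P t \<union> P (Suc t)"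
  by (simp add: protected_upto_def atLeastAtMostSuc_conv Un_commute)

lemma card_even_ge: "n \<le> card {x. l \<le> x \<and> x \<le> l + 2 * int n - 1 \<and> even (x + c)}" for l c :: int
proof -
  \<comment> \<open>The summand \<open>(l + c) mod 2\<close> moves \<open>l\<close> to the first
    position of the right parity.\<close>
  have "card {..<n} \<le> card {x. l \<le> x \<and> x \<le> l + 2 * int n - 1 \<and> even (x + c)}"
  proof (rule card_inj_on_le[of "\<lambda>i. l + (l + c) mod 2 + 2 * int i"])
    show "(\<lambda>i. l + (l + c) mod 2 + 2 * int i) ` {..<n} \<subseteq> {x. l \<le> x \<and> x \<le> l + 2 * int n - 1 \<and> even (x + c)}"
    proof clarify
      fix i assume "i < n"
      moreover have "0 \<le> (l + c) mod 2" "(l + c) mod 2 \<le> 1" by auto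
      moreover have "even (l + c + (l + c) mod 2)" by presburger
      ultimately show "l \<le> l + (l + c) mod 2 + 2 * int i \<and> l + (l + c) mod 2 + 2 * int i \<le> l + 2 * int n - 1
          \<and> even (l + (l + c) mod 2 + 2 * int i + c)"
        by (auto simp: algebra_simps)
    qed
    show "finite {x. l \<le> x \<and> x \<le> l + 2 * int n - 1 \<and> even (x + c)}"
      by (rule finite_subset[of _ "{l..l + 2 * int n - 1}"]) auto
  qed (simp add: inj_on_def)
  then show ?thesis by simp
qed

lemma slab_fire_burning:
  assumes q: "q = 1 \<or> q = 2" and h: "h \<ge> 1" and B0: "B0 \<subseteq> pverts (slab q h)" "finite B0"
    and legal: "legal_strategy (slab q h) f B0 P"
  shows "slab_fire q h (\<lambda>t. coords q ` burning (slab q h) B0 P t) (\<lambda>t. coords q ` protected_upto P t)"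
proof -
  let ?G = "slab q h"
  let ?B = "burning ?G B0 P" and ?P = "protected_upto P"
  define m where "m = Max (radius ` coords q ` B0)"
  have ball0: "coords q ` B0 \<subseteq> ball h m"
  proof (rule image_subsetI)
    fix v assume v: "v \<in> B0"
    then have "radius (coords q v) \<le> m"
      unfolding m_def using B0(2) by (intro Max_ge imageI) auto
    then show "coords q v \<in> ball h m"
      using v B0(1) by (auto simp: ball_def pverts_slab)
  qed
  have ball: "coords q ` ?B t \<subseteq> ball h (m + int t)" for t
    by (rule burning_in_ball[OF q ball0])
  have Pt: "finite (P t)" "P t \<subseteq> pverts ?G" if "t \<ge> 1" for t
    using legal that by (auto simp: legal_strategy_def)
  have step: "coords q w \<in> coords q ` ?B (Suc t) \<union> coords q ` ?P (Suc t)"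
    if "v \<in> ?B t" "(v, w) \<in> parcs ?G" for v w t
    using that by (auto simp: pverts_slab parcs_slab_iff[OF q])
  have layer: "k \<in> {1..h}" if "(c, k) \<in> coords q ` ?B t" for c k t
    using that ball[of t] by (auto simp: ball_def)
  show ?thesis
  proof
    show "q = 1 \<or> q = 2" "h \<ge> 1" by fact+
    fix t
    show "finite (coords q ` ?B t)" using ball finite_ball by (rule finite_subset)
    show "finite (coords q ` ?P t)" using Pt by (auto simp: protected_upto_def)
    show "coords q ` ?B t \<subseteq> coords q ` ?B (Suc t)" by auto
    show "coords q ` ?P t \<subseteq> coords q ` ?P (Suc t)" by (auto simp: protected_upto_Suc)
    show "k \<in> {1..h}" if "(c, k) \<in> coords q ` ?B t" for c k using layer that .
    show "k \<in> {1..h}" if "(c, k) \<in> coords q ` ?P t" for c k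
    proof -
      from that obtain v s where v: "(c, k) = coords q v" "s \<in> {1..t}" "v \<in> P s"
        by (auto simp: protected_upto_def)
      then have "snd v \<in> {1..h}" using Pt(2)[of s] by (auto simp: pverts_slab)
      then show ?thesis using v(1) snd_coords[of q v] by (metis snd_conv)
    qed
    show "even (x + y)" if "q = 1" "((x, y), k) \<in> coords q ` ?B t" for x y k
      using that range_coords[OF q, of x y k] by blast
    show "(cell d (r + 1) (x + \<delta>), k) \<in> coords q ` ?B (Suc t) \<union> coords q ` ?P (Suc t)"
      if c: "(cell d r x, k) \<in> coords q ` ?B t" and \<delta>: "\<delta> \<in> steps q" for d r x k \<delta>
    proof -
      obtain v where v: "v \<in> ?B t" "coords q v = (cell d r x, k)" using c by auto
      have "(cell d r x, k) \<in> range (coords q)" using v(2) by (metis rangeI)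
      \<comment> \<open>For \<open>q = 1\<close> both coordinates change by one, so their sum stays
        even and the target is the image of a vertex.\<close>
      then have "(cell d (r + 1) (x + \<delta>), k) \<in> range (coords q)"
        using \<delta> range_coords[OF q] by (cases d) (auto simp: steps_def)
      then obtain w where w: "coords q w = (cell d (r + 1) (x + \<delta>), k)" by (metis rangeE)
      have "adjacent (coords q v) (coords q w)"
        using \<delta> unfolding v(2) w by (cases d) (auto simp: steps_def split: if_splits)
      moreover have "snd v = k" "snd w = k" using v(2) w snd_coords by (metis snd_conv)+
      ultimately have "(v, w) \<in> parcs ?G"
        using layer[OF c] by (simp add: parcs_slab_iff[OF q])
      from step[OF v(1) this] show ?thesis by (simp add: w)
    qed
    show "(c, j) \<in> coords q ` ?B (Suc t) \<union> coords q ` ?P (Suc t)"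
      if c: "(c, k) \<in> coords q ` ?B t" and j: "j \<in> {1..h}" "\<bar>int j - int k\<bar> = 1" for c k j
    proof -
      obtain v where v: "v \<in> ?B t" "coords q v = (c, k)" using c by auto
      obtain x y where xy: "c = (x, y)" by (cases c)
      have "(c, k) \<in> range (coords q)" using v(2) by (metis rangeI)
      then have "(c, j) \<in> range (coords q)" unfolding xy range_coords[OF q] .
      then obtain w where w: "coords q w = (c, j)" by (metis rangeE)
      have "adjacent (coords q v) (coords q w)"
        using j unfolding v(2) w xy by auto
      moreover have "snd v = k" "snd w = j" using v(2) w snd_coords by (metis snd_conv)+
      ultimately have "(v, w) \<in> parcs ?G"
        using layer[OF c] j by (simp add: parcs_slab_iff[OF q])
      from step[OF v(1) this] show ?thesis by (simp add: w)
    qed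
  qed
qed

lemma card_initial_ring:
  assumes fire: "slab_fire q h B P" and n: "n \<ge> 1"
    and B: "\<And>x y k. k \<in> {1..h} \<Longrightarrow> \<bar>x\<bar> \<le> int n \<Longrightarrow> \<bar>y\<bar> \<le> int n \<Longrightarrow> (q = 1 \<Longrightarrow> even (x + y)) \<Longrightarrow> ((x, y), k) \<in> B 0"
  shows "4 * (q * h) * n \<le> card (B 0 \<inter> ring (\<lambda>d. int n))"
proof -
  interpret slab_fire q h B P by fact
  \<comment> \<open>Each side gets \<open>2 * n\<close> of its \<open>2 * n + 1\<close> positions,
    the four corners being dealt out in cyclic order. The pieces are disjoint, and their even length
    makes the parity count exact.\<close>
  define l where "l = (\<lambda>d. if d \<in> {East, South} then - int n else 1 - int n)"
  let ?S = "\<lambda>d. seg d (int n) (l d) (l d + 2 * int n - 1)"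
  have l: "- int n \<le> l d" "l d + 2 * int n - 1 \<le> int n" for d by (auto simp: l_def)
  have "q * h * n \<le> card (B 0 \<inter> ?S d)" for d
  proof -
    have "q * n \<le> card {x. l d \<le> x \<and> x \<le> l d + 2 * int n - 1 \<and> (cell d (int n) x, k) \<in> B 0}" (is "_ \<le> card ?X")
      if k: "k \<in> {1..h}" for k
    proof (cases "q = 1")
      case True
      have "n \<le> card {x. l d \<le> x \<and> x \<le> l d + 2 * int n - 1 \<and> even (x + int n)}" by (rule card_even_ge)
      also have "\<dots> \<le> card ?X"
      proof (rule card_mono)
        show "finite ?X" by (rule finite_subset[of _ "{l d..l d + 2 * int n - 1}"]) auto
        show "{x. l d \<le> x \<and> x \<le> l d + 2 * int n - 1 \<and> even (x + int n)} \<subseteq> ?X"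
          using l[of d] k by (cases d) (auto intro!: B)
      qed
      finally show ?thesis using True by simp
    next
      case False
      have "?X = {l d..l d + 2 * int n - 1}"
        using l[of d] k False by (cases d) (auto intro!: B)
      then show ?thesis using q False by simp
    qed
    then have "(\<Sum>k\<in>{1..h}. q * n) \<le> card (B 0 \<inter> ?S d)"
      using card_seg[where h = h, OF finite_B[of 0] layer_B[where t = 0], where d = d and r = "int n"] by (simp only: sum_mono)
    then show ?thesis by (simp add: algebra_simps)
  qed
  then have "(\<Sum>d\<in>(UNIV :: dir set). q * h * n) \<le> (\<Sum>d\<in>UNIV. card (B 0 \<inter> ?S d))"
    by (intro sum_mono)
  moreover have "card ({} :: ((int \<times> int) \<times> nat) set) + (\<Sum>d\<in>UNIV. card (B 0 \<inter> ?S d)) \<le> card (B 0 \<inter> ring (\<lambda>d. int n))"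
  proof (rule card_pieces_le)
    show "B 0 \<inter> ?S d \<subseteq> B 0 \<inter> ring (\<lambda>d. int n)" for d
      using l[of d] by (cases d) (auto simp: ring_iff)
    show "(B 0 \<inter> ?S d) \<inter> (B 0 \<inter> ?S d') = {}" if "d \<noteq> d'" for d d'
      using that n by (cases d; cases d'; auto simp: l_def)
  qed (auto simp: finite_B)
  ultimately show ?thesis by (simp add: UNIV_dir algebra_simps)
qed

lemma not_containable:
  assumes q: "q = 1 \<or> q = 2" and h: "h \<ge> 1"
  shows "\<exists>B0. finite B0 \<and> B0 \<subseteq> pverts (slab q h) \<and>
    \<not> containable (slab q h) (\<lambda>t. 3 / 2 * real q * real h * real t) B0"
proof -
  \<comment> \<open>One more than the left-hand side of \<open>large\<close>, whose right-hand side
    is at least \<open>n\<close> because \<open>q * h\<close> is positive.\<close>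
  define n where "n = 3 * (q * h) * (h + 1) + 14 * h
      + 5 * (h * h * (h * h + (q * h * h + 4 * (q * h) * (h + 1) + 1)) + h * h) + 1"
  let ?G = "slab q h"
  define B0 where "B0 = coords q -` ball h (int n)"
  have B0: "finite B0" "B0 \<subseteq> pverts ?G"
    unfolding B0_def using finite_coords_vimage[OF finite_ball] by (auto simp: ball_def pverts_slab)
  have "\<not> containable ?G (\<lambda>t. 3 / 2 * real q * real h * real t) B0"
  proof
    assume "containable ?G (\<lambda>t. 3 / 2 * real q * real h * real t) B0"
    then obtain P T where legal: "legal_strategy ?G (\<lambda>t. 3 / 2 * real q * real h * real t) B0 P"
      and T: "\<And>t. t \<ge> T \<Longrightarrow> burning ?G B0 P (Suc t) = burning ?G B0 P t"
      unfolding containable_def contains_fire_def by blast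
    let ?B = "\<lambda>t. coords q ` burning ?G B0 P t" and ?P = "\<lambda>t. coords q ` protected_upto P t"
    interpret slab_fire q h ?B ?P
      by (rule slab_fire_burning[OF q h B0(2,1) legal])
    have burn_T: "burning ?G B0 P t \<subseteq> burning ?G B0 P T" for t
    proof (cases "t \<le> T")
      case False
      then have "T \<le> t" by simp
      then have "burning ?G B0 P t = burning ?G B0 P T"
        by (induction t rule: dec_induct) (use T in auto)
      then show ?thesis by simp
    qed (rule burning_mono)
    have "contained_slab_fire q h ?B ?P (int n) (?B T)"
    proof
      show "2 * card (?P t) \<le> 3 * (q * h) * t" for t
      proof (cases "t = 0")
        case False
        then have "real (card (protected_upto P t)) \<le> 3 / 2 * real q * real h * real t"
          using legal by (simp add: legal_strategy_def)
        then have "real (2 * card (protected_upto P t)) \<le> real (3 * (q * h) * t)" by simp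
        moreover have "card (?P t) = card (protected_upto P t)"
          by (rule card_image[OF inj_on_subset[OF inj_coords]]) simp
        ultimately show ?thesis by linarith
      qed (simp add: protected_upto_def)
      show "int n \<ge> 1" by (simp add: n_def)
      have "4 * (q * h) * n \<le> card (?B 0 \<inter> ring (\<lambda>d. int n))"
      proof (rule card_initial_ring)
        show "slab_fire q h ?B ?P" by unfold_locales
        show "n \<ge> 1" by (simp add: n_def)
        fix x y k assume *: "k \<in> {1..h}" "\<bar>x\<bar> \<le> int n" "\<bar>y\<bar> \<le> int n" "q = 1 \<Longrightarrow> even (x + y)"
        then have "((x, y), k) \<in> range (coords q)" by (simp add: range_coords[OF q])
        then obtain v where "((x, y), k) = coords q v" by blast
        moreover have "((x, y), k) \<in> ball h (int n)" using * by (simp add: ball_def)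
        ultimately show "((x, y), k) \<in> ?B 0" by (simp add: B0_def)
      qed
      then have "4 * (q * h) * n \<le> energy 0 (\<lambda>d. int n)" by (simp add: energy_def)
      then have "int (4 * (q * h) * n) \<le> int (energy 0 (\<lambda>d. int n))" by (rule of_nat_mono)
      then show "4 * (int q * int h) * int n \<le> int (energy 0 (\<lambda>d. int n))" by simp
      show "finite (?B T)" by (rule finite_B)
      show "?B t \<subseteq> ?B T" for t using burn_T by blast
      have "n \<le> 4 * (q * h) * n" using q h by auto
      then have "int n \<le> int (4 * (q * h) * n)" by (rule of_nat_mono)
      also have "\<dots> = 4 * (int q * int h) * int n" by (simp only: of_nat_mult of_nat_numeral)
      finally show "3 * (int q * int h) * (int h + 1) + 14 * int h
          + 5 * (int h * int h * (int h * int h + (int q * int h * int h + 4 * (int q * int h) * (int h + 1) + 1)) + int h * int h)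
        < 4 * (int q * int h) * int n"
        by (rule less_le_trans[rotated]) (simp add: n_def algebra_simps)
    qed
    then show False by (rule contained_slab_fire.contradiction)
  qed
  with B0 show ?thesis by blast
qed

subsection \<open>Containment above the critical rate\<close>

lemma mono_finite_stabilises:
  fixes S :: "nat \<Rightarrow> 'a set"
  assumes mono: "\<And>s t. s \<le> t \<Longrightarrow> S s \<subseteq> S t" and fin: "finite F" and F: "\<And>t. S t \<subseteq> F"
  shows "\<exists>T. \<forall>t\<ge>T. S t = S T"
proof -
  have "finite (\<Union>t. S t)" using F fin by (meson UN_least finite_subset)
  moreover have "\<forall>v\<in>(\<Union>t. S t). \<exists>t. v \<in> S t" by blast
  ultimately obtain g where g: "\<forall>v\<in>(\<Union>t. S t). v \<in> S (g v)" using bchoice by metis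
  define T where "T = Max (insert 0 (g ` (\<Union>t. S t)))"
  have "S t \<subseteq> S T" for t
  proof
    fix v assume "v \<in> S t"
    then have "v \<in> (\<Union>t. S t)" by blast
    moreover from this have "g v \<le> T"
      unfolding T_def using \<open>finite (\<Union>t. S t)\<close> by (intro Max_ge) auto
    ultimately show "v \<in> S T" using g mono[of "g v" T] by blast
  qed
  then show ?thesis using mono by blast
qed

lemma coords_in_sites: "v \<in> pverts (slab q h) \<Longrightarrow> coords q v \<in> sites q h"
  by (cases v) (auto simp: pverts_slab sites_def)

text \<open>The ring includes its corners, so even a diagonal move cannot leap over the
  fence.\<close>

lemma adjacent_box:
  assumes "adjacent c c'" "c \<in> box b"
  shows "c' \<in> box b \<or> c' \<in> ring (\<lambda>d. b d + 1)"
  using assms by (cases "(c, c')" rule: adjacent.cases) (auto simp: ring_iff)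

definition clip_lo :: "(dir \<Rightarrow> int) \<Rightarrow> int \<Rightarrow> dir \<Rightarrow> int" where
  "clip_lo c \<tau> d = max (lo c d) (- \<tau>)"

definition clip_hi :: "(dir \<Rightarrow> int) \<Rightarrow> int \<Rightarrow> dir \<Rightarrow> int" where
  "clip_hi c \<tau> d = min (hi c d) \<tau>"

lemma card_fence:
  assumes q: "q = 1 \<or> q = 2" and c: "\<And>d. c d \<ge> 1" and \<tau>: "\<tau> \<ge> 1"
  shows "2 * int (card (sites q h \<inter> ring c \<inter> {p. radius p \<le> \<tau>}))
    \<le> (\<Sum>d\<in>UNIV. if c d \<le> \<tau> then int q * int h * (clip_hi c \<tau> d - clip_lo c \<tau> d) + 4 * int h else 0)"
proof -
  let ?S = "\<lambda>d. if c d \<le> \<tau> then sites q h \<inter> seg d (c d) (clip_lo c \<tau> d) (clip_hi c \<tau> d) else {}"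
  have fin: "finite (?S d)" for d by (simp add: finite_sites_seg)
  have c': "1 \<le> c East" "1 \<le> c West" "1 \<le> c North" "1 \<le> c South" using c by auto
  have "sites q h \<inter> ring c \<inter> {p. radius p \<le> \<tau>} \<subseteq> (\<Union>d. ?S d)"
  proof
    fix p assume p: "p \<in> sites q h \<inter> ring c \<inter> {p. radius p \<le> \<tau>}"
    then obtain d where d: "p \<in> side c d" by (auto simp: ring_def)
    obtain x y k where xyk: "p = ((x, y), k)" by (metis surj_pair)
    have "p \<in> ?S d"
      using p d c' unfolding xyk by (cases d) (auto simp: side_def clip_lo_def clip_hi_def)
    then show "p \<in> (\<Union>d. ?S d)" by blast
  qed
  then have "card (sites q h \<inter> ring c \<inter> {p. radius p \<le> \<tau>}) \<le> card (\<Union>d. ?S d)"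
    by (rule card_mono[rotated]) (intro finite_UN_I fin finite)
  also have "\<dots> \<le> (\<Sum>d\<in>UNIV. card (?S d))" by (rule card_UN_le) simp
  finally have "2 * int (card (sites q h \<inter> ring c \<inter> {p. radius p \<le> \<tau>})) \<le> (\<Sum>d\<in>UNIV. 2 * int (card (?S d)))"
    by (simp flip: sum_distrib_left of_nat_sum)
  also have "\<dots> \<le> (\<Sum>d\<in>UNIV. if c d \<le> \<tau> then int q * int h * (clip_hi c \<tau> d - clip_lo c \<tau> d) + 4 * int h else 0)"
  proof (rule sum_mono)
    fix d
    have "clip_lo c \<tau> d \<le> clip_hi c \<tau> d"
      using c' \<tau> by (cases d) (auto simp: clip_lo_def clip_hi_def)
    from card_sites_seg[OF q this]
    show "2 * int (card (?S d)) \<le> (if c d \<le> \<tau> then int q * int h * (clip_hi c \<tau> d - clip_lo c \<tau> d) + 4 * int h else 0)"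
      by simp
  qed
  finally show ?thesis .
qed

text \<open>Counts are doubled, so the allowance is
  \<open>(3 * K + 2 * \<epsilon>) * (\<tau> - n)\<close>. Demand jumps when \<tau> reaches a side,
  as a stretch of order \<tau> is due at once. At East and at West it is
  \<open>3 * K * \<tau>\<close> plus the distances of earlier sides; only \<epsilon> can pay for
  those, so \<open>cE\<close> and \<open>cW\<close> are chosen large against them. At North and at
  South it is \<open>2 * K * \<tau>\<close> plus constants, and the spare \<open>K * \<tau>\<close>
  pays.\<close>

lemma exists_rectangle:
  fixes q h :: nat and n :: int and \<epsilon> :: real
  assumes q: "q \<ge> 1" and h: "h \<ge> 1" and n: "n \<ge> 1" and \<epsilon>: "\<epsilon> > 0"
  shows "\<exists>c. (\<forall>d. n < c d) \<and> (\<forall>\<tau>\<ge>n.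
    real_of_int (\<Sum>d\<in>UNIV. if c d \<le> \<tau> then int q * int h * (clip_hi c \<tau> d - clip_lo c \<tau> d) + 4 * int h else 0)
      \<le> 2 * (3 / 2 * real q * real h + \<epsilon>) * real_of_int (\<tau> - n))"
proof -
  define K where "K = real q * real h"
  have K: "K \<ge> real h" "K > 0" using q h by (auto simp: K_def)
  \<comment> \<open>\<open>3 * n\<close> compensates for the allowance starting at radius
    \<open>n\<close>, and 16 for the rounding term \<open>16 * h\<close>, since
    \<open>h \<le> K\<close>.\<close>
  define cN where "cN = 3 * n + 16"
  define cE where "cE = cN + \<lceil>(K * (cN + 3 * n) + 16 * h) / \<epsilon>\<rceil>"
  define cW where "cW = cE + \<lceil>(K * (cE + 2 * cN + 3 * n) + 16 * h) / \<epsilon>\<rceil>"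
  define cS where "cS = 2 * cE + 2 * cW + 2 * cN + 3 * n + 16"
  define c where "c = (\<lambda>d. case d of East \<Rightarrow> cE | West \<Rightarrow> cW | North \<Rightarrow> cN | South \<Rightarrow> cS)"
  have step: "x \<le> \<epsilon> * real_of_int \<lceil>x / \<epsilon>\<rceil>" for x
  proof -
    have "x = \<epsilon> * (x / \<epsilon>)" using \<epsilon> by simp
    also have "\<dots> \<le> \<epsilon> * real_of_int \<lceil>x / \<epsilon>\<rceil>" using \<epsilon> by (intro mult_left_mono) auto
    finally show ?thesis .
  qed
  have nonneg: "0 \<le> \<lceil>x / \<epsilon>\<rceil>" if "0 \<le> x" for x
    using that \<epsilon> by (simp add: ceiling_mono[of 0, simplified])
  have N: "n < cN" using n by (simp add: cN_def)
  have E: "cN \<le> cE" "K * (cN + 3 * n) + 16 * h \<le> \<epsilon> * (cE - n)"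
  proof -
    have "0 \<le> K * (cN + 3 * n) + 16 * h" using K N n by simp
    from nonneg[OF this] show "cN \<le> cE" by (simp add: cE_def)
    have "\<epsilon> * real_of_int (cE - cN) \<le> \<epsilon> * (cE - n)" using \<epsilon> N by (intro mult_left_mono) auto
    then show "K * (cN + 3 * n) + 16 * h \<le> \<epsilon> * (cE - n)"
      using step[of "K * (cN + 3 * n) + 16 * h"] by (simp add: cE_def)
  qed
  have W: "cE \<le> cW" "K * (cE + 2 * cN + 3 * n) + 16 * h \<le> \<epsilon> * (cW - n)"
  proof -
    have "0 \<le> K * (cE + 2 * cN + 3 * n) + 16 * h" using K N n E by simp
    from nonneg[OF this] show "cE \<le> cW" by (simp add: cW_def)
    have "\<epsilon> * real_of_int (cW - cE) \<le> \<epsilon> * (cW - n)" using \<epsilon> N E by (intro mult_left_mono) auto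
    then show "K * (cE + 2 * cN + 3 * n) + 16 * h \<le> \<epsilon> * (cW - n)"
      using step[of "K * (cE + 2 * cN + 3 * n) + 16 * h"] by (simp add: cW_def)
  qed
  have S: "cW \<le> cS" using N E W n by (simp add: cS_def)
  have "\<forall>d. n < c d" using N E W S by (auto simp: c_def split: dir.split)
  moreover have "real_of_int (\<Sum>d\<in>UNIV. if c d \<le> \<tau> then int q * int h * (clip_hi c \<tau> d - clip_lo c \<tau> d) + 4 * int h else 0)
      \<le> 2 * (3 / 2 * real q * real h + \<epsilon>) * real_of_int (\<tau> - n)" (is "?lhs \<le> ?rhs") if \<tau>: "n \<le> \<tau>" for \<tau>
  proof -
    let ?len = "\<lambda>d. clip_hi c \<tau> d - clip_lo c \<tau> d"
    have len: "?len East = min cN \<tau> + min cS \<tau>" "?len West = min cN \<tau> + min cS \<tau>"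
      "?len North = min cE \<tau> + min cW \<tau>" "?len South = min cE \<tau> + min cW \<tau>"
      by (auto simp: clip_lo_def clip_hi_def c_def)
    have rhs: "?rhs = 3 * (K * \<tau>) - 3 * (K * n) + 2 * (\<epsilon> * (\<tau> - n))"
      by (simp add: K_def algebra_simps)
    have bound: "?lhs \<le> ?rhs" if "?lhs \<le> K * X + 16 * h" "K * X + 16 * h \<le> ?rhs" for X :: int
      using that by linarith
    have lhs: "?lhs \<le> K * X + 16 * h"
      if "(\<Sum>d\<in>UNIV. if c d \<le> \<tau> then ?len d else 0) \<le> X" for X
    proof -
      have "(\<Sum>d\<in>UNIV. if c d \<le> \<tau> then int q * int h * ?len d + 4 * int h else 0)
          \<le> (\<Sum>d\<in>UNIV. int q * int h * (if c d \<le> \<tau> then ?len d else 0) + 4 * int h)"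
        by (intro sum_mono) auto
      also have "\<dots> = int q * int h * (\<Sum>d\<in>UNIV. if c d \<le> \<tau> then ?len d else 0) + 16 * int h"
        by (simp add: sum_dir algebra_simps)
      also have "\<dots> \<le> int q * int h * X + 16 * int h"
        using that by (intro add_right_mono mult_left_mono) auto
      finally have "?lhs \<le> real_of_int (int q * int h * X + 16 * int h)" by (simp only: of_int_le_iff)
      then show ?thesis by (simp add: K_def)
    qed
    have eps: "\<epsilon> * (x - n) \<le> \<epsilon> * (\<tau> - n)" if "x \<le> \<tau>" for x
      using \<epsilon> that by (intro mult_left_mono) auto
    have eps0: "0 \<le> \<epsilon> * (\<tau> - n)" using \<epsilon> \<tau> by simp
    have Kle: "K * x \<le> K * y" if "x \<le> y" for x y :: int
      using K that by (intro mult_left_mono) auto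
    have Kh: "16 * real h \<le> K * 16" using K by simp
    consider "\<tau> < cN" | "cN \<le> \<tau>" "\<tau> < cE" | "cE \<le> \<tau>" "\<tau> < cW" | "cW \<le> \<tau>" "\<tau> < cS" | "cS \<le> \<tau>"
      by linarith
    then show ?thesis
    proof cases
      case 1
      then have "?lhs = 0" using E W S by (simp add: sum_dir c_def)
      then show ?thesis using K \<epsilon> \<tau> by (simp add: K_def)
    next
      case 2
      show ?thesis
      proof (rule bound[OF lhs])
        show "(\<Sum>d\<in>UNIV. if c d \<le> \<tau> then ?len d else 0) \<le> 2 * \<tau>"
          using 2 W S unfolding sum_dir len by (simp add: c_def)
        have "K * (3 * n + 16) \<le> K * \<tau>" using 2 Kle[of "3 * n + 16" \<tau>] by (simp add: cN_def)
        then show "K * (2 * \<tau>) + 16 * h \<le> ?rhs"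
          unfolding rhs using eps0 Kh by (simp add: algebra_simps)
      qed
    next
      case 3
      show ?thesis
      proof (rule bound[OF lhs])
        show "(\<Sum>d\<in>UNIV. if c d \<le> \<tau> then ?len d else 0) \<le> 3 * \<tau> + cN"
          using 3 E S unfolding sum_dir len by (simp add: c_def)
        show "K * (3 * \<tau> + cN) + 16 * h \<le> ?rhs"
          unfolding rhs using eps0 eps[OF 3(1)] E(2) by (simp add: algebra_simps)
      qed
    next
      case 4
      show ?thesis
      proof (rule bound[OF lhs])
        show "(\<Sum>d\<in>UNIV. if c d \<le> \<tau> then ?len d else 0) \<le> 3 * \<tau> + cE + 2 * cN"
          using 4 E W unfolding sum_dir len by (simp add: c_def)
        show "K * (3 * \<tau> + cE + 2 * cN) + 16 * h \<le> ?rhs"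
          unfolding rhs using eps0 eps[OF 4(1)] W(2) by (simp add: algebra_simps)
      qed
    next
      case 5
      show ?thesis
      proof (rule bound[OF lhs])
        show "(\<Sum>d\<in>UNIV. if c d \<le> \<tau> then ?len d else 0) \<le> 2 * \<tau> + 2 * cE + 2 * cW + 2 * cN"
          using 5 E W S unfolding sum_dir len by (simp add: c_def)
        have "K * cS \<le> K * \<tau>" using 5 Kle by simp
        then show "K * (2 * \<tau> + 2 * cE + 2 * cW + 2 * cN) + 16 * h \<le> ?rhs"
          unfolding rhs cS_def using eps0 Kh by (simp add: algebra_simps)
      qed
    qed
  qed
  ultimately show ?thesis by blast
qed

lemma containable_above:
  assumes q: "q = 1 \<or> q = 2" and h: "h \<ge> 1" and \<epsilon>: "\<epsilon> > 0"
    and B0: "finite B0" "B0 \<subseteq> pverts (slab q h)"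
  shows "containable (slab q h) (\<lambda>t. (3 / 2 * real q * real h + \<epsilon>) * real t) B0"
proof -
  let ?G = "slab q h"
  define n where "n = Max (insert 1 (radius ` coords q ` B0))"
  have n: "n \<ge> 1" unfolding n_def using B0(1) by (intro Max_ge) auto
  have B0_ball: "coords q ` B0 \<subseteq> ball h n"
  proof (rule image_subsetI)
    fix v assume "v \<in> B0"
    then show "coords q v \<in> ball h n"
      unfolding n_def using B0 by (auto simp: ball_def pverts_slab)
  qed
  have q1: "q \<ge> 1" using q by auto
  obtain c where c: "\<And>d. n < c d" and count: "\<And>\<tau>. n \<le> \<tau> \<Longrightarrow>
      real_of_int (\<Sum>d\<in>UNIV. if c d \<le> \<tau> then int q * int h * (clip_hi c \<tau> d - clip_lo c \<tau> d) + 4 * int h else 0)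
      \<le> 2 * (3 / 2 * real q * real h + \<epsilon>) * real_of_int (\<tau> - n)"
    using exists_rectangle[OF q1 h n \<epsilon>] by blast
  have c': "n < c East" "n < c West" "n < c North" "n < c South" using c by auto
  have c1: "c d \<ge> 1" for d using c[of d] n by linarith
  \<comment> \<open>The fire gains at most one unit of radius per turn. A cell of radius
    \<open>n + t\<close> is therefore still unburnt before turn \<open>t\<close>, and is protected
    in the first turn in which it could catch fire.\<close>
  define P where "P t = {v \<in> pverts ?G. coords q v \<in> ring c \<and> radius (coords q v) = n + int t}" for t :: nat
  let ?B = "burning ?G B0 P"
  have upto: "protected_upto P t = {v \<in> pverts ?G. coords q v \<in> ring c \<and> radius (coords q v) \<le> n + int t}" for t
  proof -
    have "n < radius p" if "p \<in> ring c" for p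
    proof -
      obtain x y k where "p = ((x, y), k)" by (metis surj_pair)
      with that c' n show ?thesis by (auto simp: ring_iff)
    qed
    then have "v \<in> protected_upto P t" if "v \<in> pverts ?G" "coords q v \<in> ring c" "radius (coords q v) \<le> n + int t" for v
      unfolding protected_upto_def P_def using that
      by (intro UN_I[of "nat (radius (coords q v) - n)"]) fastforce+
    then show ?thesis by (auto simp: protected_upto_def P_def)
  qed
  have ball: "coords q ` ?B t \<subseteq> ball h (n + int t)" for t
    by (rule burning_in_ball[OF q B0_ball])
  have inside: "coords q ` ?B t \<subseteq> box (\<lambda>d. c d - 1)" for t
  proof (induction t)
    case 0
    have "ball h n \<subseteq> box (\<lambda>d. c d - 1)" using c' by (auto simp: ball_def)
    then show ?case using B0_ball by auto
  next
    case (Suc t)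
    show ?case
    proof (rule image_subsetI)
      fix v assume v: "v \<in> ?B (Suc t)"
      show "coords q v \<in> box (\<lambda>d. c d - 1)"
      proof (cases "v \<in> ?B t")
        case True
        then show ?thesis using Suc.IH by blast
      next
        case False
        with v obtain u where u: "u \<in> ?B t" "(u, v) \<in> parcs ?G"
          and v': "v \<in> pverts ?G" "v \<notin> protected_upto P (Suc t)" by auto
        have "radius (coords q v) \<le> n + int (Suc t)"
          using ball[of "Suc t"] v by (auto simp: ball_def)
        then have "coords q v \<notin> ring c" using v' upto by auto
        moreover have "adjacent (coords q u) (coords q v)"
          using u(2) by (simp add: parcs_slab_iff[OF q])
        moreover have "coords q u \<in> box (\<lambda>d. c d - 1)" using u(1) Suc.IH by blast
        ultimately show ?thesis using adjacent_box[of "coords q u" "coords q v" "\<lambda>d. c d - 1"] by simp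
      qed
    qed
  qed
  have fin_upto: "finite (protected_upto P t)" for t
  proof (rule finite_subset)
    show "protected_upto P t \<subseteq> coords q -` ball h (n + int t)"
      by (auto simp: upto ball_def pverts_slab)
  qed (rule finite_coords_vimage[OF finite_ball])
  have "legal_strategy ?G (\<lambda>t. (3 / 2 * real q * real h + \<epsilon>) * real t) B0 P"
    unfolding legal_strategy_def
  proof (intro allI impI conjI)
    fix t :: nat assume t: "t \<ge> 1"
    show "finite (P t)"
      by (rule finite_subset[OF _ fin_upto[of t]]) (use t in \<open>auto simp: protected_upto_def\<close>)
    have "v \<notin> ?B (t - 1)" if "v \<in> P t" for v
    proof
      assume "v \<in> ?B (t - 1)"
      then have "radius (coords q v) \<le> n + int (t - 1)" using ball[of "t - 1"] by (auto simp: ball_def)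
      then show False using that t by (simp add: P_def)
    qed
    then show "P t \<subseteq> pverts ?G - ?B (t - 1)" by (auto simp: P_def)
    have "card (protected_upto P t) = card (coords q ` protected_upto P t)"
      by (rule card_image[OF inj_on_subset[OF inj_coords], symmetric]) simp
    also have "\<dots> \<le> card (sites q h \<inter> ring c \<inter> {p. radius p \<le> n + int t})"
    proof (rule card_mono)
      show "finite (sites q h \<inter> ring c \<inter> {p. radius p \<le> n + int t})"
        by (rule finite_subset[OF _ finite_ball[of h "n + int t"]]) (auto simp: ball_def sites_def)
      show "coords q ` protected_upto P t \<subseteq> sites q h \<inter> ring c \<inter> {p. radius p \<le> n + int t}"
        by (auto simp: upto coords_in_sites simp del: coords.simps)
    qed
    finally have "2 * int (card (protected_upto P t)) \<le> (\<Sum>d\<in>UNIV. if c d \<le> n + int t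
        then int q * int h * (clip_hi c (n + int t) d - clip_lo c (n + int t) d) + 4 * int h else 0)"
      using card_fence[where c = c and \<tau> = "n + int t" and h = h, OF q c1] n by linarith
    then have "real_of_int (2 * int (card (protected_upto P t))) \<le> 2 * (3 / 2 * real q * real h + \<epsilon>) * real_of_int (n + int t - n)"
      using count[of "n + int t"] by linarith
    then show "real (card (protected_upto P t)) \<le> (3 / 2 * real q * real h + \<epsilon>) * real t"
      by (simp add: algebra_simps)
  qed
  moreover have "contains_fire ?G B0 P"
  proof -
    have "finite (coords q -` (box (\<lambda>d. c d - 1) \<inter> UNIV \<times> {1..h}))"
    proof (rule finite_coords_vimage, rule finite_subset)
      show "box (\<lambda>d. c d - 1) \<inter> UNIV \<times> {1..h} \<subseteq> ({- c West..c East} \<times> {- c South..c North}) \<times> {1..h}"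
        by auto
    qed simp
    moreover have "?B t \<subseteq> coords q -` (box (\<lambda>d. c d - 1) \<inter> UNIV \<times> {1..h})" for t
    proof
      fix v assume v: "v \<in> ?B t"
      then have "coords q v \<in> box (\<lambda>d. c d - 1)" "coords q v \<in> ball h (n + int t)" using inside ball by blast+
      then show "v \<in> coords q -` (box (\<lambda>d. c d - 1) \<inter> UNIV \<times> {1..h})"
        by (cases "coords q v") (auto simp: ball_def)
    qed
    ultimately have "\<exists>T. \<forall>t\<ge>T. ?B t = ?B T"
      by (rule mono_finite_stabilises[where S = ?B, rotated]) (rule burning_mono)
    then obtain T where T: "\<And>t. t \<ge> T \<Longrightarrow> ?B t = ?B T" by blast
    have "?B (Suc t) = ?B t" if "t \<ge> T" for t
      using T[OF that] T[OF le_SucI[OF that]] by (rule trans[OF _ sym, rotated])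
    then show ?thesis unfolding contains_fire_def by blast
  qed
  ultimately show ?thesis unfolding containable_def by blast
qed

theorem theorem1:
  fixes h q :: nat
  assumes "h \<ge> 1" and "q \<in> {1, 2}"
  shows "is_critical_protection_rate (if q = 1 then G1 h else G2 h) (3 / 2 * real q * real h)"
proof -
  have q: "q = 1 \<or> q = 2" using assms(2) by simp
  show ?thesis
    using not_containable[OF q assms(1)] containable_above[OF q assms(1)]
    unfolding is_critical_protection_rate_def slab_def by auto
qed

end
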